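(* Consider a random dynamical system $S(\omega,x)=(\theta\omega,T_\omega x)$ on $\Omega\times X$ preserving $\nu=\mathbb{P}\otimes\mu_\omega$. Assume that the compact metric space $X$ has bounded local complexity, that the fiber measures $\mu_\omega$ depend in a Lipschitz way on $\omega$, and that $\theta$ mixes stretched exponentially. Then, for $\mathbb{P}$-almost every $\omega$, for $\mu_\omega^{\otimes2}$-almost every $(x,y)$, $$\limsup_{n\to\infty}\frac{-\log m_n^{>}(\omega;x,y)}{\log n}\le\frac{2}{\underline{D}_2^{\mathrm{an}}},$$ where $m_n^{>}(\omega;x,y)=\min\{d(T_\omega^ix,T_\omega^jy): 0\le i,j<n,\ |j-i|>\alpha(n)\}$.
   Context: Random dynamical system: $\Omega$ is a compact metric space with a probability measure $\mathbb{P}$, and $\theta:\Omega\to\Omega$ is invertible and preserves $\mathbb{P}$. $(X,d)$ is a metric space and, for each $\omega\in\Omega$, $T_\omega:X\to X$ is measurable, such that the skew product $S(\omega,x)=(\theta\omega,T_\omega x)$ is measurable and preserves a probability measure $\nu$ on $\Omega\times X$ whose marginal on $\Omega$ is $\mathbb{P}$. Write $T_\omega^n=T_{\theta^{n-1}\omega}\circ\dots\circ T_\omega$. The measure $\nu$ is disintegrated above $\mathbb{P}$ into probability measures $\mu_\omega$ on $X$ depending measurably on $\omega$: $\int f\,d\nu=\int(\int f(\omega,x)\,d\mu_\omega(x))\,d\mathbb{P}(\omega)$, written $\nu=\mathbb{P}\otimes\mu_\omega$; one has $(T_\omega)_*\mu_\omega=\mu_{\theta\omega}$ for $\mathbb{P}$-a.e.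 $\omega$. Let $\mu=\int\mu_\omega\,d\mathbb{P}(\omega)$ be the marginal of $\nu$ on $X$. Lipschitz norm: $\|f\|_{\mathrm{Lip}}=\|f\|_\infty+\mathrm{Lip}(f)$, where $\mathrm{Lip}(f)$ is the best Lipschitz constant of $f$. Bounded local complexity: a compact metric space $X$ has bounded local complexity if there is a constant $C_0$ such that, for every small enough $r>0$, there are $k(r)<\infty$ and points $x^{(r)}_1,\dots,x^{(r)}_{k(r)}\in X$ such that the balls $B(x^{(r)}_p,r)$, $1\le p\le k(r)$, cover $X$ and any point of $X$ belongs to at most $C_0$ of the balls $B(x^{(r)}_p,4r)$. Lower annealed correlation dimension: $\underline{D}_2^{\mathrm{an}}=\liminf_{r\to0}\frac{\log\int\mu(B(x,r))\,d\mu(x)}{\log r}$. The measures $\mu_\omega$ depend in a Lipschitz way on $\omega$: there is $C_1>0$ such that $|\int f\,d\mu_\omega-\int f\,d\mu_{\omega'}|\le C_1\|f\|_{\mathrm{Lip}}\,d(\omega,\omega')$ for every Lipschitz $f:X\to\mathbb{R}$ and all $\omega,\omega'\in\Omega$. $\theta$ mixes stretched exponentially: there are $c_2,C_2>0$ such that for all Lipschitz $f,g:\Omega\to\mathbb{R}$ and all $n\in\mathbb{N}$, $$\left|\int f\cdot g\circ\theta^n\,d\mathbb{P}-\left(\int f\,d\mathbb{P}\right)\left(\int g\,d\mathbb{P}\right)\right|\le C_2e^{-n^{c_2}}\|f\|_{\mathrm{Lip}}\|g\|_{\mathrm{Lip}}.$$ Gap function: $\alpha(n)=(\log n)^{C_4}$,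 where $C_4$ is a fixed, large enough constant: $C_4\ge2/c_2$. Conventions: $-\log0=+\infty$, $2/0=+\infty$, and the minimum of an empty set is $+\infty$ (irrelevant for large $n$). *)

theory Defs
  imports "HOL-Probability.Probability"
begin

text \<open>
  Measurable invertibility of the base map is \<open>bij \<theta>\<close> together with measurability of its inverse. The
  skew product is measurable with respect to the product \<open>\<sigma>\<close>-algebra, which for compact metric
  spaces is the Borel \<open>\<sigma>\<close>-algebra of the product. The equivariance of the fiber measures under \<open>T\<close> is
  a consequence of the axioms and is not assumed.
\<close>

locale random_dynamical_system =
  fixes P :: "'w::metric_space measure"
    and \<theta> :: "'w \<Rightarrow> 'w"
    and T :: "'w \<Rightarrow> 'x::metric_space \<Rightarrow> 'x"
    and \<nu> :: "('w \<times> 'x) measure"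
    and \<mu> :: "'w \<Rightarrow> 'x measure"
  assumes compact_base: "compact (UNIV :: 'w set)"
    and prob_base: "prob_space P"
    and sets_base: "sets P = sets borel"
    and base_bij: "bij \<theta>"
    and base_measurable: "\<theta> \<in> borel \<rightarrow>\<^sub>M borel"
    and base_inv_measurable: "inv \<theta> \<in> borel \<rightarrow>\<^sub>M borel"
    and base_invariant: "distr P P \<theta> = P"
    and fiber_map_measurable: "T \<omega> \<in> borel \<rightarrow>\<^sub>M borel"
    and skew_measurable:
      "(\<lambda>(\<omega>, x). (\<theta> \<omega>, T \<omega> x)) \<in> borel \<Otimes>\<^sub>M borel \<rightarrow>\<^sub>M borel \<Otimes>\<^sub>M borel"
    and prob_total: "prob_space \<nu>"
    and sets_total: "sets \<nu> = sets (borel \<Otimes>\<^sub>M borel)"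
    and skew_invariant: "distr \<nu> \<nu> (\<lambda>(\<omega>, x). (\<theta> \<omega>, T \<omega> x)) = \<nu>"
    and base_marginal: "distr \<nu> P fst = P"
    and fiber_measurable: "\<mu> \<in> P \<rightarrow>\<^sub>M prob_algebra borel"
    and disintegration:
      "\<And>f :: 'w \<times> 'x \<Rightarrow> ennreal. f \<in> borel_measurable (borel \<Otimes>\<^sub>M borel) \<Longrightarrow>
        (\<integral>\<^sup>+ z. f z \<partial>\<nu>) = (\<integral>\<^sup>+ \<omega>. (\<integral>\<^sup>+ x. f (\<omega>, x) \<partial>\<mu> \<omega>) \<partial>P)"

primrec fiber_iter :: "('w \<Rightarrow> 'w) \<Rightarrow> ('w \<Rightarrow> 'x \<Rightarrow> 'x) \<Rightarrow> nat \<Rightarrow> 'w \<Rightarrow> 'x \<Rightarrow> 'x" where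
  "fiber_iter \<theta> T 0 \<omega> = id"
| "fiber_iter \<theta> T (Suc n) \<omega> = T ((\<theta> ^^ n) \<omega>) \<circ> fiber_iter \<theta> T n \<omega>"

definition is_lipschitz :: "('a::metric_space \<Rightarrow> real) \<Rightarrow> bool" where
  "is_lipschitz f \<longleftrightarrow> (\<exists>L. L-lipschitz_on UNIV f)"

text \<open>Only meaningful for bounded Lipschitz functions (all Lipschitz functions, on a compact space).\<close>

definition lip_norm :: "('a::metric_space \<Rightarrow> real) \<Rightarrow> real" where
  "lip_norm f = (SUP x. \<bar>f x\<bar>) + Inf {L. L-lipschitz_on UNIV f}"

definition bounded_local_complexity :: "'a::metric_space set \<Rightarrow> bool" where
  "bounded_local_complexity X \<longleftrightarrow>
    (\<exists>C\<^sub>0 :: nat. \<forall>\<^sub>F r in at_right (0::real).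
      \<exists>(k :: nat) (c :: nat \<Rightarrow> 'a).
        (\<forall>p\<in>{1..k}. c p \<in> X) \<and>
        X \<subseteq> (\<Union>p\<in>{1..k}. ball (c p) r) \<and>
        (\<forall>z\<in>X. card {p\<in>{1..k}. z \<in> ball (c p) (4 * r)} \<le> C\<^sub>0))"

definition lipschitz_fibers :: "('w::metric_space \<Rightarrow> 'x::metric_space measure) \<Rightarrow> bool" where
  "lipschitz_fibers \<mu> \<longleftrightarrow>
    (\<exists>C\<^sub>1 > 0. \<forall>f \<omega> \<omega>'. is_lipschitz f \<longrightarrow>
      \<bar>(\<integral>x. f x \<partial>\<mu> \<omega>) - (\<integral>x. f x \<partial>\<mu> \<omega>')\<bar> \<le> C\<^sub>1 * lip_norm f * dist \<omega> \<omega>')"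

definition mixes_stretched_exponentially ::
    "'w::metric_space measure \<Rightarrow> ('w \<Rightarrow> 'w) \<Rightarrow> real \<Rightarrow> real \<Rightarrow> bool" where
  "mixes_stretched_exponentially P \<theta> c\<^sub>2 C\<^sub>2 \<longleftrightarrow> c\<^sub>2 > 0 \<and> C\<^sub>2 > 0 \<and>
    (\<forall>f g n. is_lipschitz f \<longrightarrow> is_lipschitz g \<longrightarrow>
      \<bar>(\<integral>\<omega>. f \<omega> * g ((\<theta> ^^ n) \<omega>) \<partial>P) - (\<integral>\<omega>. f \<omega> \<partial>P) * (\<integral>\<omega>. g \<omega> \<partial>P)\<bar>
        \<le> C\<^sub>2 * exp (- (real n powr c\<^sub>2)) * lip_norm f * lip_norm g)"

text \<open>Logarithm with \<open>log 0 = -\<infinity>\<close> and \<open>log \<infinity> = \<infinity>\<close>; the values at negative arguments are immaterial.\<close>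

definition elog :: "ereal \<Rightarrow> ereal" where
  "elog x = (if x \<le> 0 then -\<infinity> else if x = \<infinity> then \<infinity> else ereal (ln (real_of_ereal x)))"

definition lower_correlation_dimension :: "'x::metric_space measure \<Rightarrow> ereal" where
  "lower_correlation_dimension m =
    Liminf (at_right 0) (\<lambda>r. elog (ereal (\<integral>x. measure m (ball x r) \<partial>m)) / ereal (ln r))"

text \<open>The annealed dimension is that of the marginal of \<open>\<nu>\<close> on the second factor.\<close>

definition lower_annealed_dimension :: "('w \<times> 'x::metric_space) measure \<Rightarrow> ereal" where
  "lower_annealed_dimension \<nu> = lower_correlation_dimension (distr \<nu> borel snd)"

definition gap :: "real \<Rightarrow> nat \<Rightarrow> real" where
  "gap C\<^sub>4 n = ln (real n) powr C\<^sub>4"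

text \<open>A minimum over a finite set, written as an infimum in \<open>ereal\<close> so that it is \<open>\<infinity>\<close> over the empty set.\<close>

definition min_dist_gap ::
    "('w \<Rightarrow> 'w) \<Rightarrow> ('w \<Rightarrow> 'x::metric_space \<Rightarrow> 'x) \<Rightarrow> (nat \<Rightarrow> real) \<Rightarrow> nat \<Rightarrow> 'w \<Rightarrow> 'x \<Rightarrow> 'x \<Rightarrow> ereal" where
  "min_dist_gap \<theta> T \<alpha> n \<omega> x y =
    Inf {ereal (dist (fiber_iter \<theta> T i \<omega> x) (fiber_iter \<theta> T j \<omega> y)) | i j.
      i < n \<and> j < n \<and> \<bar>real j - real i\<bar> > \<alpha> n}"

end

theory Submission
  imports Defs
begin

text \<open>
  The proof is a first moment computation followed by Borel--Cantelli. Let \<open>m\<close> be the marginal of \<open>\<nu>\<close> on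
  \<open>X\<close>. Fix a real \<open>s > 2 / D\<close>, where \<open>D\<close> is the lower annealed correlation dimension, and choose
  \<open>D' < D\<close> with \<open>s D' > 2\<close>. Then the correlation integral of \<open>m\<close> at scale \<open>r\<close> is at most \<open>r\<^sup>D\<^sup>'\<close> for all
  small \<open>r\<close>.

  Cover \<open>X\<close> by \<open>k(r)\<close> balls of radius \<open>r\<close> with bounded multiplicity. If \<open>T\<^sup>i \<omega> x\<close> and \<open>T\<^sup>j \<omega> y\<close> are
  \<open>r\<close>-close, some ball of the cover has both of them in its double. For a fixed ball, equivariance of
  the fiber measures bounds the probability of this by \<open>F(\<theta>\<^sup>i \<omega>) F(\<theta>\<^sup>j \<omega>)\<close>, where \<open>F(\<omega>)\<close> is the integral
  against \<open>\<mu> \<omega>\<close> of a Lipschitz cutoff around the ball. As the fiber measures depend on \<open>\<omega>\<close> in a Lipschitz way,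
  \<open>F\<close> is Lipschitz with norm of order \<open>1 / r\<close>, and mixing gives a mean value close to the square of
  the mean of \<open>F\<close>, that is, at most about \<open>m(B)\<^sup>2\<close> for the concentric ball \<open>B\<close> of radius \<open>4r\<close>
  (\<open>cutoff_correlation_le\<close>). By bounded multiplicity these squares sum to at most a constant times the
  correlation integral at scale \<open>8r\<close> (\<open>sum_squared_measures_le_correlation_integral\<close>).

  Take \<open>n = 2\<^sup>l\<close> and \<open>r = n\<^sup>-\<^sup>s\<close>. Summing over the order of \<open>n\<^sup>2\<close> pairs of times, the main terms contribute
  \<open>n\<^sup>2 r\<^sup>D\<^sup>'\<close>, up to a constant, which is summable in \<open>l\<close> because \<open>s D' > 2\<close>. The mixing errors are smaller
  than any power of \<open>n\<close>, since times in a counted pair differ by more than \<open>(ln n)\<^sup>C\<close> where \<open>C = C\<^sub>4\<close> and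
  \<open>C\<^sub>4 c\<^sub>2 \<ge> 2\<close>. They multiply \<open>k(r)\<close>, so it matters that bounded local complexity makes \<open>k(r)\<close> grow at most
  polynomially in \<open>1 / r\<close> (\<open>bounded_local_complexity_covers\<close>). Borel--Cantelli then shows that, almost
  surely, no such encounter happens for large \<open>l\<close> (\<open>dyadic_separation\<close>); monotonicity fills in the
  times between powers of two (\<open>limsup_min_dist_gap_le\<close>), and \<open>s\<close> decreases to \<open>2 / D\<close> through rational values.
\<close>

section \<open>Lipschitz functions and cutoffs\<close>

lemma lip_norm_le:
  fixes f :: "'a::metric_space \<Rightarrow> real"
  assumes "\<And>x. \<bar>f x\<bar> \<le> B" and L: "L-lipschitz_on UNIV f"
  shows "lip_norm f \<le> B + L"
proof -
  have "(SUP x. \<bar>f x\<bar>) \<le> B"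
    using assms by (intro cSUP_least) auto
  moreover have "bdd_below {L. L-lipschitz_on UNIV f}"
    by (rule bdd_belowI[of _ 0]) (auto dest: lipschitz_on_nonneg)
  then have "Inf {L. L-lipschitz_on UNIV f} \<le> L"
    using L by (intro cInf_lower) auto
  ultimately show ?thesis
    unfolding lip_norm_def by linarith
qed

lemma lip_norm_nonneg:
  fixes f :: "'a::metric_space \<Rightarrow> real"
  assumes B: "\<And>x. \<bar>f x\<bar> \<le> B" and L: "L-lipschitz_on UNIV f"
  shows "0 \<le> lip_norm f"
proof -
  have "\<bar>f undefined\<bar> \<le> (SUP x. \<bar>f x\<bar>)"
    using B by (intro cSUP_upper) (auto intro!: bdd_aboveI[of _ B])
  moreover have "0 \<le> Inf {L. L-lipschitz_on UNIV f}"
    using L by (intro cInf_greatest) (auto dest: lipschitz_on_nonneg)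
  ultimately show ?thesis
    unfolding lip_norm_def by linarith
qed

text \<open>
  The cutoff equals \<open>1\<close> on \<open>B(z, 2r)\<close> and vanishes off \<open>B(z, 4r)\<close>. Two points at distance less than
  \<open>r\<close>, one of which is in \<open>B(z, r)\<close>, both lie in the inner ball; the outer ball is the one whose
  multiplicity is controlled by bounded local complexity.
\<close>

definition cutoff :: "'a::metric_space \<Rightarrow> real \<Rightarrow> 'a \<Rightarrow> real" where
  "cutoff z r x = min 1 (max 0 (3 - dist x z / r))"

lemma cutoff_nonneg: "0 \<le> cutoff z r x" and cutoff_le_1: "cutoff z r x \<le> 1"
  by (auto simp: cutoff_def)

lemma cutoff_eq_1: "r > 0 \<Longrightarrow> x \<in> ball z (2 * r) \<Longrightarrow> cutoff z r x = 1"
  by (auto simp: cutoff_def dist_commute field_simps min_def max_def)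

lemma cutoff_eq_0: "r > 0 \<Longrightarrow> x \<notin> ball z (4 * r) \<Longrightarrow> cutoff z r x = 0"
  by (auto simp: cutoff_def dist_commute field_simps min_def max_def)

lemma cutoff_lipschitz:
  assumes "r > 0"
  shows "(1 / r)-lipschitz_on UNIV (cutoff z r)"
proof (rule lipschitz_onI)
  fix x y
  have "\<bar>cutoff z r x - cutoff z r y\<bar> \<le> \<bar>dist x z / r - dist y z / r\<bar>"
    unfolding cutoff_def by linarith
  also have "\<dots> = \<bar>dist x z - dist y z\<bar> / r"
    using assms by (simp flip: diff_divide_distrib)
  also have "\<dots> \<le> dist x y / r"
    using assms abs_dist_diff_le[of x z y] by (simp add: divide_right_mono dist_commute)
  finally show "dist (cutoff z r x) (cutoff z r y) \<le> 1 / r * dist x y"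
    by (simp add: dist_real_def)
qed (use assms in auto)

lemma cutoff_borel [measurable]: "r > 0 \<Longrightarrow> cutoff z r \<in> borel_measurable borel"
  by (intro borel_measurable_continuous_onI lipschitz_on_continuous_on[OF cutoff_lipschitz])

section \<open>Covers of bounded multiplicity\<close>

definition bounded_cover :: "nat \<Rightarrow> real \<Rightarrow> nat \<Rightarrow> (nat \<Rightarrow> 'a::metric_space) \<Rightarrow> bool" where
  "bounded_cover C r k c \<longleftrightarrow> UNIV \<subseteq> (\<Union>p\<in>{1..k}. ball (c p) r) \<and>
     (\<forall>z. card {p\<in>{1..k}. z \<in> ball (c p) (4 * r)} \<le> C)"

text \<open>
  Every center \<open>c p\<close> is within \<open>s \<le> 4r\<close> of some center \<open>y q\<close>, and by bounded multiplicity a given \<open>y q\<close>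
  lies in at most \<open>C\<close> of the balls \<open>B(c p, 4r)\<close>. So a cover of bounded multiplicity is within a constant
  factor of any cover whose balls have four times the radius.
\<close>

lemma bounded_cover_size_le:
  fixes c y :: "nat \<Rightarrow> 'a::metric_space"
  assumes c: "bounded_cover C r k c" and y: "UNIV \<subseteq> (\<Union>q\<in>{1..l}. ball (y q) s)" and "s \<le> 4 * r"
  shows "k \<le> C * l"
proof -
  have "{1..k} \<subseteq> (\<Union>q\<in>{1..l}. {p\<in>{1..k}. y q \<in> ball (c p) (4 * r)})"
  proof
    fix p assume p: "p \<in> {1..k}"
    obtain q where "q \<in> {1..l}" "c p \<in> ball (y q) s"
      using y by blast
    with p \<open>s \<le> 4 * r\<close> show "p \<in> (\<Union>q\<in>{1..l}. {p\<in>{1..k}. y q \<in> ball (c p) (4 * r)})"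
      by (auto simp: dist_commute intro!: bexI[of _ q])
  qed
  then have "card {1..k} \<le> card (\<Union>q\<in>{1..l}. {p\<in>{1..k}. y q \<in> ball (c p) (4 * r)})"
    by (intro card_mono) auto
  also have "\<dots> \<le> (\<Sum>q\<in>{1..l}. card {p\<in>{1..k}. y q \<in> ball (c p) (4 * r)})"
    by (intro card_UN_le) auto
  also have "\<dots> \<le> (\<Sum>q\<in>{1..l}. C)"
    using c by (intro sum_mono) (auto simp: bounded_cover_def)
  finally show ?thesis
    by (simp add: mult.commute)
qed

text \<open>
  Bounded local complexity does not mention the number \<open>k(r)\<close> of balls, but it forces
  \<open>k(r) \<le> C k(4r)\<close>; iterating this up to a fixed scale \<open>r\<^sub>0\<close> gives \<open>k(r) \<le> K r\<^sup>-\<^sup>A\<close> as soon as \<open>C \<le> 4\<^sup>A\<close>.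
  This polynomial growth is what lets the error term of the mixing hypothesis be summed over all
  balls.
\<close>

lemma bounded_local_complexity_covers:
  assumes "bounded_local_complexity (UNIV :: 'a::metric_space set)"
  obtains C A :: nat and K r\<^sub>0 :: real and k :: "real \<Rightarrow> nat" and c :: "real \<Rightarrow> nat \<Rightarrow> 'a::metric_space"
  where "r\<^sub>0 > 0"
    and "\<And>r. 0 < r \<Longrightarrow> r \<le> r\<^sub>0 \<Longrightarrow> bounded_cover C r (k r) (c r)"
    and "\<And>r. 0 < r \<Longrightarrow> r \<le> r\<^sub>0 \<Longrightarrow> real (k r) * r ^ A \<le> K"
proof -
  obtain C where "\<forall>\<^sub>F r in at_right 0. \<exists>k c. bounded_cover C r k (c :: nat \<Rightarrow> 'a)"
    using assms unfolding bounded_local_complexity_def bounded_cover_def by auto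
  then obtain b where "b > 0" and b: "\<And>r. 0 < r \<Longrightarrow> r < b \<Longrightarrow> \<exists>k c. bounded_cover C r k (c :: nat \<Rightarrow> 'a)"
    unfolding eventually_at_right_field by blast
  then have "\<forall>r. \<exists>k c. 0 < r \<and> r < b \<longrightarrow> bounded_cover C r k (c :: nat \<Rightarrow> 'a)"
    by blast
  then obtain k and c :: "real \<Rightarrow> nat \<Rightarrow> 'a::metric_space"
    where kc: "\<And>r. 0 < r \<Longrightarrow> r < b \<Longrightarrow> bounded_cover C r (k r) (c r)"
    by metis
  define r\<^sub>0 where "r\<^sub>0 = b / 2"
  have r\<^sub>0: "0 < r\<^sub>0" "r\<^sub>0 < b"
    using \<open>b > 0\<close> by (auto simp: r\<^sub>0_def)
  obtain A :: nat where "real C < 4 ^ A"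
    using real_arch_pow[of 4 "real C"] by auto
  have step: "k r \<le> C * k s" if "0 < r" "r < b" "0 < s" "s < b" "s \<le> 4 * r" for r s
    using bounded_cover_size_le[OF kc[OF that(1,2)]] kc[OF that(3,4)] that(5)
    unfolding bounded_cover_def by metis
  define K where "K = real C * real (k r\<^sub>0) * r\<^sub>0 ^ A"
  \<comment> \<open>Induction on the number \<open>m\<close> of factors \<open>4\<close> between \<open>r\<close> and \<open>r\<^sub>0\<close>.\<close>
  have bound: "real (k r) * r ^ A \<le> K" if "0 < r" "r \<le> r\<^sub>0" "r\<^sub>0 \<le> 4 ^ m * r" for r m
    using that
  proof (induction m arbitrary: r rule: nat.induct)
    case zero
    then have "r\<^sub>0 \<le> 4 * r"
      by simp
    then have "k r \<le> C * k r\<^sub>0"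
      using step[of r r\<^sub>0] zero r\<^sub>0 by auto
    then have "real (k r) \<le> real C * real (k r\<^sub>0)"
      by (metis of_nat_le_iff of_nat_mult)
    then show ?case
      unfolding K_def using zero by (intro mult_mono power_mono) auto
  next
    case (Suc m)
    show ?case
    proof (cases "r\<^sub>0 \<le> 4 * r")
      case True
      then have "k r \<le> C * k r\<^sub>0"
        using step[of r r\<^sub>0] Suc.prems r\<^sub>0 by auto
      then have "real (k r) \<le> real C * real (k r\<^sub>0)"
        by (metis of_nat_le_iff of_nat_mult)
      then show ?thesis
        unfolding K_def using Suc.prems by (intro mult_mono power_mono) auto
    next
      case False
      have "k r \<le> C * k (4 * r)"
        using step[of r "4 * r"] False Suc.prems r\<^sub>0 by auto
      then have "real (k r) \<le> real C * real (k (4 * r))"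
        by (metis of_nat_le_iff of_nat_mult)
      also have "\<dots> \<le> 4 ^ A * real (k (4 * r))"
        using \<open>real C < 4 ^ A\<close> by (intro mult_right_mono) auto
      finally have "real (k r) * r ^ A \<le> 4 ^ A * real (k (4 * r)) * r ^ A"
        using Suc.prems by (intro mult_right_mono) auto
      also have "\<dots> = real (k (4 * r)) * (4 * r) ^ A"
        by (simp add: power_mult_distrib)
      also have "\<dots> \<le> K"
        using Suc False by (intro Suc.IH) auto
      finally show ?thesis .
    qed
  qed
  have "real (k r) * r ^ A \<le> K" if "0 < r" "r \<le> r\<^sub>0" for r
  proof -
    obtain m where "r\<^sub>0 / r < 4 ^ m"
      using real_arch_pow[of 4 "r\<^sub>0 / r"] by auto
    then show ?thesis
      using that by (intro bound[of r m]) (auto simp: field_simps)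
  qed
  then show ?thesis
    using r\<^sub>0 kc by (intro that[of r\<^sub>0 C k c A K]) auto
qed

section \<open>The correlation integral\<close>

text \<open>
  The mass of a ball is a lower semicontinuous function of its center: if \<open>B(x, r)\<close> has mass more than
  \<open>a\<close>, so has \<open>B(x, r - \<delta>)\<close> for some \<open>\<delta> > 0\<close>, and it is contained in \<open>B(y, r)\<close> for all \<open>y\<close> that are
  \<open>\<delta>\<close>-close to \<open>x\<close>.
\<close>

lemma measure_ball_measurable:
  fixes m :: "'a::metric_space measure"
  assumes "prob_space m" and [measurable_cong]: "sets m = sets borel"
  shows "(\<lambda>x. measure m (ball x r)) \<in> borel_measurable borel"
proof (rule borel_measurableI_greater)
  interpret prob_space m by fact
  fix a :: real
  have "\<exists>d>0. \<forall>y. dist y x < d \<longrightarrow> a < measure m (ball y r)" if x: "a < measure m (ball x r)" for x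
  proof -
    have "(\<lambda>n. measure m (ball x (r - 1 / Suc n))) \<longlonglongrightarrow> measure m (\<Union>n. ball x (r - 1 / Suc n))"
    proof (rule finite_Lim_measure_incseq)
      show "incseq (\<lambda>n. ball x (r - 1 / real (Suc n)))"
        by (intro monoI subset_ball diff_left_mono divide_left_mono) auto
    qed auto
    moreover have "(\<Union>n. ball x (r - 1 / Suc n)) = ball x r"
    proof safe
      fix y assume "y \<in> ball x r"
      then have "0 < r - dist x y" by simp
      then obtain n where "1 / real (Suc n) < r - dist x y"
        using nat_approx_posE by blast
      then show "y \<in> (\<Union>n. ball x (r - 1 / Suc n))"
        by (intro UN_I[of n]) (auto simp del: of_nat_Suc)
    next
      fix y n assume "y \<in> ball x (r - 1 / real (Suc n))"
      moreover have "0 < 1 / real (Suc n)" by simp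
      ultimately show "y \<in> ball x r"
        unfolding mem_ball by linarith
    qed
    ultimately have "\<forall>\<^sub>F n in sequentially. a < measure m (ball x (r - 1 / Suc n))"
      using x by (intro order_tendstoD) auto
    then obtain n where n: "a < measure m (ball x (r - 1 / Suc n))"
      unfolding eventually_sequentially by blast
    have "a < measure m (ball y r)" if "dist y x < 1 / Suc n" for y
    proof -
      have "ball x (r - 1 / Suc n) \<subseteq> ball y r"
      proof
        fix z assume "z \<in> ball x (r - 1 / Suc n)"
        then show "z \<in> ball y r"
          using that dist_triangle[of y z x] unfolding mem_ball by linarith
      qed
      then have "measure m (ball x (r - 1 / Suc n)) \<le> measure m (ball y r)"
        by (intro finite_measure_mono) auto
      with n show ?thesis by simp
    qed
    then show ?thesis
      by (intro exI[of _ "1 / Suc n"]) auto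
  qed
  then have "open {x. a < measure m (ball x r)}"
    unfolding open_dist by blast
  then show "{x \<in> space borel. a < measure m (ball x r)} \<in> sets borel"
    by simp
qed

definition correlation_integral :: "'a::metric_space measure \<Rightarrow> real \<Rightarrow> real" where
  "correlation_integral m r = (\<integral>x. measure m (ball x r) \<partial>m)"

lemma correlation_integral_bounds:
  assumes "prob_space m" and "sets m = sets borel"
  shows "0 \<le> correlation_integral m r" "correlation_integral m r \<le> 1"
proof -
  interpret prob_space m by fact
  show "0 \<le> correlation_integral m r"
    unfolding correlation_integral_def by (intro integral_nonneg_AE) auto
  show "correlation_integral m r \<le> 1"
    unfolding correlation_integral_def
    by (intro integral_le_const integrable_const_bound[of _ 1])
       (use measure_ball_measurable[OF assms] assms(2) in \<open>auto cong: measurable_cong_sets\<close>)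
qed

text \<open>
  The square of \<open>m(B)\<close>, for \<open>B = B(c p, 4r)\<close>, is the integral of \<open>m(B)\<close> over \<open>x \<in> B\<close>, where
  \<open>B \<subseteq> B(x, 8r)\<close>. Each \<open>x\<close> is counted at most \<open>C\<close> times in the sum over \<open>p\<close>.
\<close>

lemma sum_squared_measures_le_correlation_integral:
  fixes m :: "'a::metric_space measure"
  assumes m: "prob_space m" "sets m = sets borel" and c: "bounded_cover C r k c"
  shows "(\<Sum>p\<in>{1..k}. (measure m (ball (c p) (4 * r)))\<^sup>2) \<le> C * correlation_integral m (8 * r)"
proof -
  interpret prob_space m by fact
  note [measurable_cong] = m(2)
  note [measurable] = measure_ball_measurable[OF m]
  have [measurable]: "ball z s \<in> sets borel" for z :: 'a and s
    by simp
  let ?B = "\<lambda>p. ball (c p) (4 * r)"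
  have int: "integrable m (\<lambda>x. indicator (?B p) x * measure m (?B p))" for p
    by (intro integrable_const_bound[of _ 1]) (auto simp: mult_le_one)
  have "(\<Sum>p\<in>{1..k}. (measure m (?B p))\<^sup>2) =
      (\<Sum>p\<in>{1..k}. \<integral>x. indicator (?B p) x * measure m (?B p) \<partial>m)"
    using m(2)[THEN sets_eq_imp_space_eq] by (simp add: power2_eq_square)
  also have "\<dots> = (\<integral>x. (\<Sum>p\<in>{1..k}. indicator (?B p) x * measure m (?B p)) \<partial>m)"
    using int by (subst Bochner_Integration.integral_sum) auto
  also have "\<dots> \<le> (\<integral>x. C * measure m (ball x (8 * r)) \<partial>m)"
  proof (rule integral_mono)
    show "integrable m (\<lambda>x. \<Sum>p\<in>{1..k}. indicator (?B p) x * measure m (?B p))"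
      by (intro Bochner_Integration.integrable_sum int)
    show "integrable m (\<lambda>x. C * measure m (ball x (8 * r)))"
      by (intro integrable_mult_right integrable_const_bound[of _ 1]) auto
  next
    fix x
    let ?I = "{p\<in>{1..k}. x \<in> ?B p}"
    have "(\<Sum>p\<in>{1..k}. indicator (?B p) x * measure m (?B p)) = (\<Sum>p\<in>?I. measure m (?B p))"
      by (auto simp: indicator_def sum.If_cases Int_def if_distrib[of "\<lambda>u. u * _"] cong: if_cong)
    also have "\<dots> \<le> (\<Sum>p\<in>?I. measure m (ball x (8 * r)))"
    proof (intro sum_mono finite_measure_mono)
      fix p assume p: "p \<in> ?I"
      show "?B p \<subseteq> ball x (8 * r)"
      proof
        fix z assume "z \<in> ?B p"
        with p show "z \<in> ball x (8 * r)"
          using dist_triangle[of x z "c p"] by (auto simp: dist_commute)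
      qed
    qed auto
    also have "\<dots> = real (card ?I) * measure m (ball x (8 * r))"
      by simp
    also have "\<dots> \<le> C * measure m (ball x (8 * r))"
      using c by (intro mult_right_mono) (auto simp: bounded_cover_def)
    finally show "(\<Sum>p\<in>{1..k}. indicator (?B p) x * measure m (?B p)) \<le> C * measure m (ball x (8 * r))" .
  qed
  finally show ?thesis
    by (simp add: correlation_integral_def)
qed

lemma lower_correlation_dimension_nonneg:
  assumes "prob_space m" and "sets m = sets borel"
  shows "0 \<le> lower_correlation_dimension m"
  unfolding lower_correlation_dimension_def
proof (rule Liminf_bounded)
  have "\<forall>\<^sub>F r in at_right 0. (0::real) < r \<and> r < 1"
    by (auto simp: eventually_at_right_field intro!: exI[of _ 1])
  then show "\<forall>\<^sub>F r in at_right 0. 0 \<le> elog (ereal (\<integral>x. measure m (ball x r) \<partial>m)) / ereal (ln r)"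
  proof eventually_elim
    case (elim r)
    then have "ln r < 0" by simp
    let ?I = "correlation_integral m r"
    have "0 \<le> elog (ereal ?I) / ereal (ln r)"
    proof (cases "?I = 0")
      case True
      with \<open>ln r < 0\<close> show ?thesis by (simp add: elog_def)
    next
      case False
      with correlation_integral_bounds[OF assms, of r] have "0 < ?I" "ln ?I \<le> 0"
        by auto
      with \<open>ln r < 0\<close> show ?thesis by (simp add: elog_def zero_le_divide_iff)
    qed
    then show ?case by (simp add: correlation_integral_def)
  qed
qed

lemma correlation_integral_le_powr:
  assumes m: "prob_space m" "sets m = sets borel"
    and D: "ereal D < lower_correlation_dimension m"
  shows "\<forall>\<^sub>F r in at_right 0. correlation_integral m r \<le> r powr D"
proof -
  have "\<forall>\<^sub>F r in at_right 0. ereal D < elog (ereal (\<integral>x. measure m (ball x r) \<partial>m)) / ereal (ln r)"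
    using D unfolding lower_correlation_dimension_def by (rule less_LiminfD)
  moreover have "\<forall>\<^sub>F r in at_right 0. (0::real) < r \<and> r < 1"
    by (auto simp: eventually_at_right_field intro!: exI[of _ 1])
  ultimately show ?thesis
  proof eventually_elim
    case (elim r)
    then have "ln r < 0" by simp
    let ?I = "correlation_integral m r"
    show ?case
    proof (cases "?I = 0")
      case False
      with correlation_integral_bounds[OF m, of r] have "0 < ?I" by auto
      then have "D < ln ?I / ln r"
        using elim \<open>ln r < 0\<close> by (simp add: elog_def flip: correlation_integral_def)
      then have "ln ?I < D * ln r"
        using \<open>ln r < 0\<close> by (simp add: field_simps)
      then have "exp (ln ?I) < exp (D * ln r)"
        by (simp only: exp_less_cancel_iff)
      with \<open>0 < ?I\<close> elim show ?thesis
        by (simp add: powr_def)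
    qed simp
  qed
qed

section \<open>Borel--Cantelli in the fibers\<close>

text \<open>
  Tonelli turns summability of the expected bounds into summability of the bounds at almost every
  point of the base, where the usual Borel--Cantelli lemma then applies in the fiber. Bounding the
  masses of the events by functions \<open>H l\<close> leaves only the measurability of \<open>H l\<close> in \<open>\<omega>\<close> to check, not
  that of the masses themselves.
\<close>

lemma fibered_borel_cantelli:
  fixes H :: "nat \<Rightarrow> 'a \<Rightarrow> real" and M :: "'a \<Rightarrow> 'b measure"
  assumes int: "\<And>l. integrable P (H l)" and nonneg: "\<And>l \<omega>. 0 \<le> H l \<omega>"
    and sum: "summable (\<lambda>l. \<integral>\<omega>. H l \<omega> \<partial>P)"
    and prob: "\<And>\<omega>. prob_space (M \<omega>)" and sets: "\<And>l \<omega>. A l \<omega> \<in> sets (M \<omega>)"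
    and le: "AE \<omega> in P. \<forall>l. measure (M \<omega>) (A l \<omega>) \<le> H l \<omega>"
  shows "AE \<omega> in P. AE z in M \<omega>. \<forall>\<^sub>F l in sequentially. z \<notin> A l \<omega>"
proof -
  note [measurable] = borel_measurable_integrable[OF int]
  have "(\<integral>\<^sup>+\<omega>. (\<Sum>l. ennreal (H l \<omega>)) \<partial>P) = (\<Sum>l. \<integral>\<^sup>+\<omega>. ennreal (H l \<omega>) \<partial>P)"
    by (intro nn_integral_suminf) auto
  also have "\<dots> = (\<Sum>l. ennreal (\<integral>\<omega>. H l \<omega> \<partial>P))"
    using int nonneg by (simp add: nn_integral_eq_integral)
  also have "\<dots> = ennreal (\<Sum>l. \<integral>\<omega>. H l \<omega> \<partial>P)"
    using nonneg sum by (intro suminf_ennreal2) auto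
  finally have "AE \<omega> in P. (\<Sum>l. ennreal (H l \<omega>)) \<noteq> \<infinity>"
    by (intro nn_integral_noteq_infinite) auto
  with le show ?thesis
  proof eventually_elim
    case (elim \<omega>)
    interpret prob_space "M \<omega>" by (rule prob)
    have "summable (\<lambda>l. H l \<omega>)"
      using elim(2) nonneg by (intro summable_suminf_not_top) auto
    then have "summable (\<lambda>l. measure (M \<omega>) (A l \<omega>))"
      by (rule summable_comparison_test'[where N = 0]) (simp add: elim(1))
    then have "AE z in M \<omega>. \<forall>\<^sub>F l in sequentially. z \<in> space (M \<omega>) - A l \<omega>"
      using sets by (intro borel_cantelli_AE1) (auto simp: emeasure_eq_measure)
    then show ?case
      by eventually_elim (auto elim: eventually_mono)
  qed
qed

section \<open>Iterates of the skew product\<close>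

lemma distr_funpow:
  assumes f: "f \<in> measurable M M" and inv: "distr M M f = M"
  shows "distr M M (f ^^ n) = M"
proof (induction n)
  case 0
  show ?case by (simp add: id_def distr_id)
next
  case (Suc n)
  have "distr M M (f ^^ Suc n) = distr (distr M M (f ^^ n)) M f"
    using f by (subst distr_distr) auto
  then show ?case by (simp only: Suc inv)
qed

context random_dynamical_system
begin

sublocale base: prob_space P
  by (rule prob_base)

sublocale total: prob_space \<nu>
  by (rule prob_total)

lemmas [measurable_cong] = sets_base sets_total

lemmas [measurable] = base_measurable base_inv_measurable fiber_map_measurable

lemma space_P [simp]: "space P = UNIV"
  using sets_eq_imp_space_eq[OF sets_base] by simp

lemma sets_fiber [measurable_cong]: "sets (\<mu> \<omega>) = sets borel"
  and prob_fiber: "prob_space (\<mu> \<omega>)"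
  using measurable_space[OF fiber_measurable, of \<omega>] by (auto simp: space_prob_algebra)

lemma space_fiber [simp]: "space (\<mu> \<omega>) = UNIV"
  using sets_eq_imp_space_eq[OF sets_fiber] by simp

lemma fiber_iter_measurable [measurable]: "fiber_iter \<theta> T n \<omega> \<in> borel \<rightarrow>\<^sub>M borel"
  by (induction n) (auto intro: measurable_comp fiber_map_measurable)

lemma skew_funpow:
  "((\<lambda>(\<omega>, x). (\<theta> \<omega>, T \<omega> x)) ^^ n) (\<omega>, x) = ((\<theta> ^^ n) \<omega>, fiber_iter \<theta> T n \<omega> x)"
  by (induction n) auto

lemma base_funpow_invariant: "distr P P (\<theta> ^^ n) = P"
  using base_invariant by (intro distr_funpow) auto

lemma skew_funpow_invariant: "distr \<nu> \<nu> ((\<lambda>(\<omega>, x). (\<theta> \<omega>, T \<omega> x)) ^^ n) = \<nu>"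
  using skew_invariant skew_measurable
  by (intro distr_funpow) (auto simp: measurable_cong_sets[OF sets_total sets_total])

lemma fiber_nn_integral_measurable:
  assumes "f \<in> borel_measurable (borel \<Otimes>\<^sub>M borel)"
  shows "(\<lambda>\<omega>. \<integral>\<^sup>+x. f (\<omega>, x) \<partial>\<mu> \<omega>) \<in> borel_measurable P"
proof (rule nn_integral_measurable_subprob_algebra2)
  show "(\<lambda>(\<omega>, x). f (\<omega>, x)) \<in> borel_measurable (P \<Otimes>\<^sub>M borel)"
    using assms by (simp add: measurable_cong_sets[OF sets_pair_measure_cong[OF sets_base refl] refl])
  show "\<mu> \<in> P \<rightarrow>\<^sub>M subprob_algebra borel"
    by (rule measurable_prob_algebraD[OF fiber_measurable])
qed

text \<open>
  Equivariance of the fiber measures, \<open>(T\<^sup>n \<omega>)\<^sub>* (\<mu> \<omega>) = \<mu> (\<theta>\<^sup>n \<omega>)\<close>, tested against one function \<open>f\<close>. Invariance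
  of \<open>\<nu>\<close> and of \<open>P\<close> shows that both sides have the same integral against \<open>h \<circ> \<theta>\<^sup>n\<close> for every \<open>h\<close>;
  since \<open>\<theta>\<close> has a measurable inverse, every measurable function of \<open>\<omega>\<close> has this form.
\<close>

lemma fiber_nn_integral_iter:
  fixes f :: "'x \<Rightarrow> ennreal"
  assumes f [measurable]: "f \<in> borel_measurable borel"
  shows "AE \<omega> in P. (\<integral>\<^sup>+x. f (fiber_iter \<theta> T n \<omega> x) \<partial>\<mu> \<omega>) = (\<integral>\<^sup>+x. f x \<partial>\<mu> ((\<theta> ^^ n) \<omega>))"
proof -
  define S where "S = (\<lambda>(\<omega>, x). (\<theta> \<omega>, T \<omega> x)) ^^ n"
  have S: "S (\<omega>, x) = ((\<theta> ^^ n) \<omega>, fiber_iter \<theta> T n \<omega> x)" for \<omega> x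
    by (simp add: S_def skew_funpow)
  have [measurable]: "S \<in> borel \<Otimes>\<^sub>M borel \<rightarrow>\<^sub>M borel \<Otimes>\<^sub>M borel"
    unfolding S_def using skew_measurable by (rule measurable_compose_n)
  have S_inv: "distr \<nu> \<nu> S = \<nu>"
    unfolding S_def by (rule skew_funpow_invariant)
  define G where "G \<omega> = (\<integral>\<^sup>+x. f (fiber_iter \<theta> T n \<omega> x) \<partial>\<mu> \<omega>)" for \<omega>
  define G' where "G' \<omega> = (\<integral>\<^sup>+x. f x \<partial>\<mu> \<omega>)" for \<omega>
  have "(\<lambda>z. f (snd (S z))) \<in> borel_measurable (borel \<Otimes>\<^sub>M borel)"
    by measurable
  from fiber_nn_integral_measurable[OF this] have [measurable]: "G \<in> borel_measurable P"
    by (simp add: S G_def[abs_def])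
  have "(\<lambda>z. f (snd z)) \<in> borel_measurable (borel \<Otimes>\<^sub>M borel)"
    by measurable
  from fiber_nn_integral_measurable[OF this] have [measurable]: "G' \<in> borel_measurable P"
    by (simp add: G'_def[abs_def])
  have "density P G = density P (\<lambda>\<omega>. G' ((\<theta> ^^ n) \<omega>))"
  proof (rule measure_eqI)
    fix A assume "A \<in> sets (density P G)"
    then have A [measurable]: "A \<in> sets P" "A \<in> sets borel" by (auto simp: sets_base)
    define h where "h \<omega> = (indicator A ((inv \<theta> ^^ n) \<omega>) :: ennreal)" for \<omega>
    have [measurable]: "h \<in> borel_measurable borel"
      unfolding h_def by measurable
    have h: "h ((\<theta> ^^ n) \<omega>) = indicator A \<omega>" for \<omega>
      using base_bij bij_fn[OF base_bij, of n]
      by (simp add: h_def inv_fn[symmetric] bij_is_inj)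
    have "emeasure (density P G) A = (\<integral>\<^sup>+\<omega>. G \<omega> * h ((\<theta> ^^ n) \<omega>) \<partial>P)"
      by (simp add: emeasure_density h)
    also have "\<dots> = (\<integral>\<^sup>+\<omega>. (\<integral>\<^sup>+x. f (snd (S (\<omega>, x))) * h (fst (S (\<omega>, x))) \<partial>\<mu> \<omega>) \<partial>P)"
      unfolding S fst_conv snd_conv G_def by (simp add: nn_integral_multc)
    also have "\<dots> = (\<integral>\<^sup>+z. f (snd (S z)) * h (fst (S z)) \<partial>\<nu>)"
      by (rule disintegration[symmetric]) measurable
    also have "\<dots> = (\<integral>\<^sup>+z. f (snd z) * h (fst z) \<partial>distr \<nu> \<nu> S)"
      by (rule nn_integral_distr[symmetric]) measurable
    also have "\<dots> = (\<integral>\<^sup>+z. f (snd z) * h (fst z) \<partial>\<nu>)"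
      unfolding S_inv ..
    also have "\<dots> = (\<integral>\<^sup>+\<omega>. G' \<omega> * h \<omega> \<partial>P)"
      by (subst disintegration) (auto simp: G'_def nn_integral_multc)
    also have "\<dots> = (\<integral>\<^sup>+\<omega>. G' \<omega> * h \<omega> \<partial>distr P P (\<theta> ^^ n))"
      unfolding base_funpow_invariant ..
    also have "\<dots> = (\<integral>\<^sup>+\<omega>. G' ((\<theta> ^^ n) \<omega>) * h ((\<theta> ^^ n) \<omega>) \<partial>P)"
      by (rule nn_integral_distr) measurable
    also have "\<dots> = emeasure (density P (\<lambda>\<omega>. G' ((\<theta> ^^ n) \<omega>))) A"
      by (simp add: emeasure_density h)
    finally show "emeasure (density P G) A = emeasure (density P (\<lambda>\<omega>. G' ((\<theta> ^^ n) \<omega>))) A" .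
  qed simp
  then have "AE \<omega> in P. G \<omega> = G' ((\<theta> ^^ n) \<omega>)"
    by (subst (asm) base.density_unique_iff) auto
  then show ?thesis
    by (simp add: G_def G'_def)
qed

section \<open>Close encounters of two orbits\<close>

definition marginal :: "'x measure" where
  "marginal = distr \<nu> borel snd"

lemma prob_marginal: "prob_space marginal" and sets_marginal [measurable_cong]: "sets marginal = sets borel"
  unfolding marginal_def by (auto intro!: total.prob_space_distr)

definition fiber_cutoff :: "'x \<Rightarrow> real \<Rightarrow> 'w \<Rightarrow> real" where
  "fiber_cutoff z r \<omega> = (\<integral>x. cutoff z r x \<partial>\<mu> \<omega>)"

lemma integrable_cutoff: "r > 0 \<Longrightarrow> integrable (\<mu> \<omega>) (cutoff z r)"
proof -
  assume r: "r > 0"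
  interpret prob_space "\<mu> \<omega>" by (rule prob_fiber)
  show ?thesis
    using r by (intro integrable_const_bound[of _ 1]) (auto simp: cutoff_nonneg cutoff_le_1)
qed

lemma fiber_cutoff_nonneg: "0 \<le> fiber_cutoff z r \<omega>"
  unfolding fiber_cutoff_def by (intro integral_nonneg_AE) (auto simp: cutoff_nonneg)

lemma fiber_cutoff_le_1: "r > 0 \<Longrightarrow> fiber_cutoff z r \<omega> \<le> 1"
proof -
  assume r: "r > 0"
  interpret prob_space "\<mu> \<omega>" by (rule prob_fiber)
  show ?thesis
    unfolding fiber_cutoff_def using integrable_cutoff[OF r]
    by (intro integral_le_const) (auto simp: cutoff_le_1)
qed

lemma nn_integral_cutoff:
  "r > 0 \<Longrightarrow> (\<integral>\<^sup>+x. ennreal (cutoff z r x) \<partial>\<mu> \<omega>) = ennreal (fiber_cutoff z r \<omega>)"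
  unfolding fiber_cutoff_def
  by (intro nn_integral_eq_integral integrable_cutoff) (auto simp: cutoff_nonneg)

text \<open>
  By equivariance, the cutoff evaluated along the orbit becomes the function \<open>fiber_cutoff z r\<close>
  evaluated at \<open>\<theta>\<^sup>n \<omega>\<close>; after this step only the dynamics on the base matters.
\<close>

lemma fiber_ball_le_fiber_cutoff:
  assumes r: "r > 0"
  shows "AE \<omega> in P. measure (\<mu> \<omega>) (fiber_iter \<theta> T n \<omega> -` ball z (2 * r)) \<le> fiber_cutoff z r ((\<theta> ^^ n) \<omega>)"
proof -
  have "AE \<omega> in P. (\<integral>\<^sup>+x. ennreal (cutoff z r (fiber_iter \<theta> T n \<omega> x)) \<partial>\<mu> \<omega>) =
      (\<integral>\<^sup>+x. ennreal (cutoff z r x) \<partial>\<mu> ((\<theta> ^^ n) \<omega>))"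
    using r by (intro fiber_nn_integral_iter) auto
  then show ?thesis
  proof eventually_elim
    case (elim \<omega>)
    interpret prob_space "\<mu> \<omega>" by (rule prob_fiber)
    let ?A = "fiber_iter \<theta> T n \<omega> -` ball z (2 * r)"
    have A: "?A \<in> sets (\<mu> \<omega>)"
      using measurable_sets[OF fiber_iter_measurable, of "ball z (2 * r)" n \<omega>] by (simp add: sets_fiber)
    have "emeasure (\<mu> \<omega>) ?A = (\<integral>\<^sup>+x. indicator ?A x \<partial>\<mu> \<omega>)"
      using A by simp
    also have "\<dots> \<le> (\<integral>\<^sup>+x. ennreal (cutoff z r (fiber_iter \<theta> T n \<omega> x)) \<partial>\<mu> \<omega>)"
      using r by (intro nn_integral_mono) (auto simp: indicator_def cutoff_eq_1 simp del: mem_ball)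
    also have "\<dots> = ennreal (fiber_cutoff z r ((\<theta> ^^ n) \<omega>))"
      using elim r by (simp add: nn_integral_cutoff)
    finally show ?case
      by (simp add: emeasure_eq_measure fiber_cutoff_nonneg)
  qed
qed

text \<open>
  This set is a measurable rectangle and its mass under \<open>\<mu> \<omega> \<Otimes>\<^sub>M \<mu> \<omega>\<close> is a product. The set of pairs with
  close iterates is handled through finitely many such rectangles.
\<close>

definition near :: "'w \<Rightarrow> nat \<Rightarrow> nat \<Rightarrow> 'x \<Rightarrow> real \<Rightarrow> ('x \<times> 'x) set" where
  "near \<omega> i j z r = (fiber_iter \<theta> T i \<omega> -` ball z (2 * r)) \<times> (fiber_iter \<theta> T j \<omega> -` ball z (2 * r))"

lemma near_sets [measurable]: "near \<omega> i j z r \<in> sets (\<mu> \<omega> \<Otimes>\<^sub>M \<mu> \<omega>)"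
proof -
  have "fiber_iter \<theta> T n \<omega> -` ball z (2 * r) \<in> sets (\<mu> \<omega>)" for n
    using measurable_sets[OF fiber_iter_measurable, of "ball z (2 * r)" n \<omega>] by (simp add: sets_fiber)
  then show ?thesis
    unfolding near_def by auto
qed

lemma measure_near_le:
  assumes r: "r > 0"
  shows "AE \<omega> in P. \<forall>i j. measure (\<mu> \<omega> \<Otimes>\<^sub>M \<mu> \<omega>) (near \<omega> i j z r)
    \<le> fiber_cutoff z r ((\<theta> ^^ i) \<omega>) * fiber_cutoff z r ((\<theta> ^^ j) \<omega>)"
proof -
  have "AE \<omega> in P. \<forall>n. measure (\<mu> \<omega>) (fiber_iter \<theta> T n \<omega> -` ball z (2 * r)) \<le> fiber_cutoff z r ((\<theta> ^^ n) \<omega>)"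
    using fiber_ball_le_fiber_cutoff[OF r] by (simp add: AE_all_countable)
  then show ?thesis
  proof eventually_elim
    case (elim \<omega>)
    interpret prob_space "\<mu> \<omega>" by (rule prob_fiber)
    have [simp]: "fiber_iter \<theta> T n \<omega> -` ball z (2 * r) \<in> sets (\<mu> \<omega>)" for n
      using measurable_sets[OF fiber_iter_measurable, of "ball z (2 * r)" n \<omega>] by (simp add: sets_fiber)
    have "measure (\<mu> \<omega> \<Otimes>\<^sub>M \<mu> \<omega>) (near \<omega> i j z r) =
      measure (\<mu> \<omega>) (fiber_iter \<theta> T i \<omega> -` ball z (2 * r)) * measure (\<mu> \<omega>) (fiber_iter \<theta> T j \<omega> -` ball z (2 * r))" for i j
      unfolding near_def by (simp add: measure_def emeasure_pair_measure_Times enn2real_mult)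
    with elim show ?case
      by (auto intro!: mult_mono fiber_cutoff_nonneg)
  qed
qed

lemma expectation_fiber_cutoff_le:
  assumes r: "r > 0" and meas: "fiber_cutoff z r \<in> borel_measurable P"
  shows "(\<integral>\<omega>. fiber_cutoff z r \<omega> \<partial>P) \<le> measure marginal (ball z (4 * r))"
proof -
  interpret m: prob_space marginal by (rule prob_marginal)
  have [measurable]: "ball z s \<in> sets borel" for s by simp
  have "ennreal (\<integral>\<omega>. fiber_cutoff z r \<omega> \<partial>P) = (\<integral>\<^sup>+\<omega>. ennreal (fiber_cutoff z r \<omega>) \<partial>P)"
    using meas r
    by (intro nn_integral_eq_integral[symmetric] base.integrable_const_bound[of _ 1])
       (auto simp: fiber_cutoff_nonneg fiber_cutoff_le_1)
  also have "\<dots> = (\<integral>\<^sup>+\<omega>. (\<integral>\<^sup>+x. ennreal (cutoff z r (snd (\<omega>, x))) \<partial>\<mu> \<omega>) \<partial>P)"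
    using r by (simp add: nn_integral_cutoff)
  also have "\<dots> = (\<integral>\<^sup>+w. ennreal (cutoff z r (snd w)) \<partial>\<nu>)"
    using r by (intro disintegration[symmetric]) measurable
  also have "\<dots> = (\<integral>\<^sup>+x. ennreal (cutoff z r x) \<partial>marginal)"
    unfolding marginal_def using r by (subst nn_integral_distr) auto
  also have "\<dots> \<le> (\<integral>\<^sup>+x. indicator (ball z (4 * r)) x \<partial>marginal)"
    using r by (intro nn_integral_mono)
      (auto simp: indicator_def cutoff_le_1 cutoff_eq_0 simp del: mem_ball)
  also have "\<dots> = ennreal (measure marginal (ball z (4 * r)))"
    by (simp add: m.emeasure_eq_measure)
  finally show ?thesis by simp
qed

lemma fiber_cutoff_lipschitz:
  assumes r: "r > 0" and C\<^sub>1: "C\<^sub>1 \<ge> 0"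
    and lip: "\<And>f \<omega> \<omega>'. is_lipschitz f \<Longrightarrow>
      \<bar>(\<integral>x. f x \<partial>\<mu> \<omega>) - (\<integral>x. f x \<partial>\<mu> \<omega>')\<bar> \<le> C\<^sub>1 * lip_norm f * dist \<omega> \<omega>'"
  shows "(C\<^sub>1 * (1 + 1 / r))-lipschitz_on UNIV (fiber_cutoff z r)"
proof (rule lipschitz_onI)
  fix \<omega> \<omega>'
  have norm: "lip_norm (cutoff z r) \<le> 1 + 1 / r"
    using r by (intro lip_norm_le cutoff_lipschitz) (auto simp: cutoff_nonneg cutoff_le_1)
  have "dist (fiber_cutoff z r \<omega>) (fiber_cutoff z r \<omega>') \<le> C\<^sub>1 * lip_norm (cutoff z r) * dist \<omega> \<omega>'"
    using lip[of "cutoff z r" \<omega> \<omega>'] cutoff_lipschitz[OF r]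
    unfolding fiber_cutoff_def dist_real_def is_lipschitz_def by blast
  also have "\<dots> \<le> C\<^sub>1 * (1 + 1 / r) * dist \<omega> \<omega>'"
    using norm C\<^sub>1 by (intro mult_right_mono mult_left_mono) auto
  finally show "dist (fiber_cutoff z r \<omega>) (fiber_cutoff z r \<omega>') \<le> C\<^sub>1 * (1 + 1 / r) * dist \<omega> \<omega>'" .
qed (use r C\<^sub>1 in auto)

lemma lipschitz_borel: "L-lipschitz_on UNIV f \<Longrightarrow> f \<in> borel_measurable P" for f :: "'w \<Rightarrow> real"
  using borel_measurable_continuous_onI[OF lipschitz_on_continuous_on[of L UNIV f]]
  by (simp add: measurable_cong_sets[OF sets_base refl])

lemma cutoff_correlation_integrable:
  assumes r: "r > 0" and L: "L-lipschitz_on UNIV (fiber_cutoff z r)"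
  shows "integrable P (\<lambda>\<omega>. fiber_cutoff z r ((\<theta> ^^ i) \<omega>) * fiber_cutoff z r ((\<theta> ^^ j) \<omega>))"
proof -
  have [measurable]: "fiber_cutoff z r \<in> borel_measurable P"
    using L by (rule lipschitz_borel)
  show ?thesis
    using r by (intro base.integrable_const_bound[of _ 1])
      (auto simp: abs_mult fiber_cutoff_nonneg fiber_cutoff_le_1 intro!: mult_le_one)
qed

text \<open>
  Stationarity reduces the correlation of the times \<open>i\<close> and \<open>j\<close> to that of \<open>0\<close> and \<open>\<bar>j - i\<bar>\<close>, to
  which the mixing hypothesis applies because \<open>fiber_cutoff z r\<close> is Lipschitz on the base. The mean of
  \<open>fiber_cutoff z r\<close> is the integral of the cutoff against the marginal of \<open>\<nu>\<close>, which produces the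
  annealed measure of the ball.
\<close>

lemma cutoff_correlation_le:
  assumes r: "r > 0" and L: "L-lipschitz_on UNIV (fiber_cutoff z r)"
    and mix: "mixes_stretched_exponentially P \<theta> c\<^sub>2 C\<^sub>2"
  shows "(\<integral>\<omega>. fiber_cutoff z r ((\<theta> ^^ i) \<omega>) * fiber_cutoff z r ((\<theta> ^^ j) \<omega>) \<partial>P)
    \<le> (measure marginal (ball z (4 * r)))\<^sup>2 + C\<^sub>2 * exp (- (\<bar>real j - real i\<bar> powr c\<^sub>2)) * (1 + L)\<^sup>2"
proof (induction i j rule: linorder_wlog)
  case (le i j)
  let ?F = "fiber_cutoff z r"
  have meas [measurable]: "?F \<in> borel_measurable P"
    using L by (rule lipschitz_borel)
  have norm: "lip_norm ?F \<le> 1 + L" "0 \<le> lip_norm ?F"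
    using L r
    by (auto intro!: lip_norm_le lip_norm_nonneg[of _ 1] simp: fiber_cutoff_nonneg fiber_cutoff_le_1)
  have "(\<integral>\<omega>. ?F ((\<theta> ^^ i) \<omega>) * ?F ((\<theta> ^^ j) \<omega>) \<partial>P) =
      (\<integral>\<omega>. ?F ((\<theta> ^^ i) \<omega>) * ?F ((\<theta> ^^ (j - i)) ((\<theta> ^^ i) \<omega>)) \<partial>P)"
    using le funpow_add[of "j - i" i \<theta>] by simp
  also have "\<dots> = (\<integral>\<omega>. ?F \<omega> * ?F ((\<theta> ^^ (j - i)) \<omega>) \<partial>distr P P (\<theta> ^^ i))"
    by (rule integral_distr[symmetric]) measurable
  also have "\<dots> = (\<integral>\<omega>. ?F \<omega> * ?F ((\<theta> ^^ (j - i)) \<omega>) \<partial>P)"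
    unfolding base_funpow_invariant ..
  also have "\<dots> \<le> (\<integral>\<omega>. ?F \<omega> \<partial>P) * (\<integral>\<omega>. ?F \<omega> \<partial>P)
      + C\<^sub>2 * exp (- (real (j - i) powr c\<^sub>2)) * lip_norm ?F * lip_norm ?F"
  proof -
    have "is_lipschitz ?F"
      using L by (auto simp: is_lipschitz_def)
    then have "\<bar>(\<integral>\<omega>. ?F \<omega> * ?F ((\<theta> ^^ (j - i)) \<omega>) \<partial>P) - (\<integral>\<omega>. ?F \<omega> \<partial>P) * (\<integral>\<omega>. ?F \<omega> \<partial>P)\<bar>
        \<le> C\<^sub>2 * exp (- (real (j - i) powr c\<^sub>2)) * lip_norm ?F * lip_norm ?F"
      using mix unfolding mixes_stretched_exponentially_def by blast
    then show ?thesis by linarith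
  qed
  also have "\<dots> \<le> measure marginal (ball z (4 * r)) * measure marginal (ball z (4 * r))
      + C\<^sub>2 * exp (- (real (j - i) powr c\<^sub>2)) * (1 + L) * (1 + L)"
  proof (rule add_mono)
    have "0 \<le> (\<integral>\<omega>. ?F \<omega> \<partial>P)"
      by (intro integral_nonneg_AE) (simp add: fiber_cutoff_nonneg)
    with expectation_fiber_cutoff_le[OF r meas]
    show "(\<integral>\<omega>. ?F \<omega> \<partial>P) * (\<integral>\<omega>. ?F \<omega> \<partial>P)
        \<le> measure marginal (ball z (4 * r)) * measure marginal (ball z (4 * r))"
      by (intro mult_mono) auto
    have "0 \<le> C\<^sub>2"
      using mix by (simp add: mixes_stretched_exponentially_def)
    with norm show "C\<^sub>2 * exp (- (real (j - i) powr c\<^sub>2)) * lip_norm ?F * lip_norm ?F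
        \<le> C\<^sub>2 * exp (- (real (j - i) powr c\<^sub>2)) * (1 + L) * (1 + L)"
      by (intro mult_mono mult_nonneg_nonneg) auto
  qed
  finally show ?case
    using le by (simp add: power2_eq_square of_nat_diff mult.assoc)
next
  case (sym i j)
  then show ?case by (simp add: mult.commute abs_minus_commute)
qed

definition encounters :: "(nat \<times> nat) set \<Rightarrow> nat \<Rightarrow> (nat \<Rightarrow> 'x) \<Rightarrow> real \<Rightarrow> 'w \<Rightarrow> ('x \<times> 'x) set" where
  "encounters S k c r \<omega> = (\<Union>(i, j)\<in>S. \<Union>p\<in>{1..k}. near \<omega> i j (c p) r)"

definition encounter_bound :: "(nat \<times> nat) set \<Rightarrow> nat \<Rightarrow> (nat \<Rightarrow> 'x) \<Rightarrow> real \<Rightarrow> 'w \<Rightarrow> real" where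
  "encounter_bound S k c r \<omega> = (\<Sum>(i, j)\<in>S. \<Sum>p\<in>{1..k}.
     fiber_cutoff (c p) r ((\<theta> ^^ i) \<omega>) * fiber_cutoff (c p) r ((\<theta> ^^ j) \<omega>))"

text \<open>
  If the two iterates were \<open>r\<close>-close, the ball of the cover that contains the first would have both in
  its double.
\<close>

lemma dist_ge_outside_encounters:
  assumes c: "bounded_cover C r k c" and "(x, y) \<notin> encounters S k c r \<omega>" and "(i, j) \<in> S"
  shows "r \<le> dist (fiber_iter \<theta> T i \<omega> x) (fiber_iter \<theta> T j \<omega> y)"
proof (rule ccontr)
  assume *: "\<not> r \<le> dist (fiber_iter \<theta> T i \<omega> x) (fiber_iter \<theta> T j \<omega> y)"
  have "fiber_iter \<theta> T i \<omega> x \<in> (\<Union>p\<in>{1..k}. ball (c p) r)"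
    using c unfolding bounded_cover_def by blast
  then obtain p where p: "p \<in> {1..k}" "dist (c p) (fiber_iter \<theta> T i \<omega> x) < r"
    by auto
  have "dist (c p) (fiber_iter \<theta> T j \<omega> y) < 2 * r"
    using p * dist_triangle[of "c p" "fiber_iter \<theta> T j \<omega> y" "fiber_iter \<theta> T i \<omega> x"] by linarith
  moreover have "dist (c p) (fiber_iter \<theta> T i \<omega> x) < 2 * r"
    using p zero_le_dist[of "c p" "fiber_iter \<theta> T i \<omega> x"] by linarith
  ultimately have "(x, y) \<in> encounters S k c r \<omega>"
    unfolding encounters_def near_def using p assms(3)
    by (intro UN_I[of "(i, j)"]) auto
  with assms(2) show False ..
qed

lemma encounters_sets: "finite S \<Longrightarrow> encounters S k c r \<omega> \<in> sets (\<mu> \<omega> \<Otimes>\<^sub>M \<mu> \<omega>)"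
  unfolding encounters_def by (intro sets.finite_UN) (auto split: prod.splits)

lemma encounter_bound_nonneg: "0 \<le> encounter_bound S k c r \<omega>"
  unfolding encounter_bound_def
  by (auto intro!: sum_nonneg mult_nonneg_nonneg fiber_cutoff_nonneg split: prod.splits)

lemma measure_encounters_le:
  assumes r: "r > 0" and S: "finite S"
  shows "AE \<omega> in P. measure (\<mu> \<omega> \<Otimes>\<^sub>M \<mu> \<omega>) (encounters S k c r \<omega>) \<le> encounter_bound S k c r \<omega>"
proof -
  have "AE \<omega> in P. \<forall>p. \<forall>i j. measure (\<mu> \<omega> \<Otimes>\<^sub>M \<mu> \<omega>) (near \<omega> i j (c p) r)
    \<le> fiber_cutoff (c p) r ((\<theta> ^^ i) \<omega>) * fiber_cutoff (c p) r ((\<theta> ^^ j) \<omega>)"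
    using measure_near_le[OF r] by (subst AE_all_countable) blast
  then show ?thesis
  proof eventually_elim
    case (elim \<omega>)
    let ?M = "\<mu> \<omega> \<Otimes>\<^sub>M \<mu> \<omega>"
    interpret pair_prob_space "\<mu> \<omega>" "\<mu> \<omega>"
      using prob_fiber by (simp add: pair_prob_space_def pair_sigma_finite_def prob_space_imp_sigma_finite)
    have "measure ?M (encounters S k c r \<omega>)
        \<le> (\<Sum>e\<in>S. measure ?M (\<Union>p\<in>{1..k}. near \<omega> (fst e) (snd e) (c p) r))"
      unfolding encounters_def split_beta using S by (intro P.finite_measure_subadditive_finite) auto
    also have "\<dots> \<le> (\<Sum>e\<in>S. \<Sum>p\<in>{1..k}. measure ?M (near \<omega> (fst e) (snd e) (c p) r))"
      by (intro sum_mono P.finite_measure_subadditive_finite) auto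
    also have "\<dots> \<le> encounter_bound S k c r \<omega>"
      unfolding encounter_bound_def split_beta using elim by (intro sum_mono) auto
    finally show ?case .
  qed
qed

lemma encounter_bound_integrable:
  assumes r: "r > 0" and L: "\<And>z. L-lipschitz_on UNIV (fiber_cutoff z r)"
  shows "integrable P (encounter_bound S k c r)"
  unfolding encounter_bound_def[abs_def] split_beta
  by (intro Bochner_Integration.integrable_sum cutoff_correlation_integrable[OF r L])

text \<open>
  For each pair of times, the main terms sum to at most \<open>C\<close> times the correlation integral at scale \<open>8r\<close>,
  and the mixing errors add up over the
  \<open>k\<close> balls of the cover.
\<close>

lemma expectation_encounter_bound_le:
  assumes r: "r > 0" and L: "\<And>z. L-lipschitz_on UNIV (fiber_cutoff z r)"
    and mix: "mixes_stretched_exponentially P \<theta> c\<^sub>2 C\<^sub>2"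
    and c: "bounded_cover C r k c"
    and g: "0 \<le> g" "\<And>i j. (i, j) \<in> S \<Longrightarrow> g \<le> \<bar>real j - real i\<bar>"
  shows "(\<integral>\<omega>. encounter_bound S k c r \<omega> \<partial>P)
    \<le> card S * (C * correlation_integral marginal (8 * r) + k * (C\<^sub>2 * exp (- (g powr c\<^sub>2)) * (1 + L)\<^sup>2))"
proof -
  let ?m = "\<lambda>p. measure marginal (ball (c p) (4 * r))" and ?E = "C\<^sub>2 * exp (- (g powr c\<^sub>2)) * (1 + L)\<^sup>2"
  let ?F = "\<lambda>e p \<omega>. fiber_cutoff (c p) r ((\<theta> ^^ fst e) \<omega>) * fiber_cutoff (c p) r ((\<theta> ^^ snd e) \<omega>)"
  have "0 < C\<^sub>2" "0 < c\<^sub>2"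
    using mix by (auto simp: mixes_stretched_exponentially_def)
  have int: "integrable P (?F e p)" for e p
    by (rule cutoff_correlation_integrable[OF r L])
  have "(\<integral>\<omega>. encounter_bound S k c r \<omega> \<partial>P) = (\<Sum>e\<in>S. \<Sum>p\<in>{1..k}. \<integral>\<omega>. ?F e p \<omega> \<partial>P)"
    unfolding encounter_bound_def split_beta
    using int by (simp add: Bochner_Integration.integral_sum)
  also have "\<dots> \<le> (\<Sum>e\<in>S. \<Sum>p\<in>{1..k}. (?m p)\<^sup>2 + ?E)"
  proof (intro sum_mono)
    fix e p assume e: "e \<in> S"
    have "g powr c\<^sub>2 \<le> \<bar>real (snd e) - real (fst e)\<bar> powr c\<^sub>2"
      using g(1) g(2)[of "fst e" "snd e"] e \<open>0 < c\<^sub>2\<close> by (intro powr_mono2) auto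
    then have "C\<^sub>2 * exp (- (\<bar>real (snd e) - real (fst e)\<bar> powr c\<^sub>2)) * (1 + L)\<^sup>2 \<le> ?E"
      using \<open>0 < C\<^sub>2\<close> by (intro mult_right_mono mult_left_mono) auto
    then show "(\<integral>\<omega>. ?F e p \<omega> \<partial>P) \<le> (?m p)\<^sup>2 + ?E"
      using cutoff_correlation_le[OF r L mix, of "c p" "fst e" "snd e"] by linarith
  qed
  also have "\<dots> = card S * ((\<Sum>p\<in>{1..k}. (?m p)\<^sup>2) + k * ?E)"
    by (simp add: sum.distrib)
  also have "\<dots> \<le> card S * (C * correlation_integral marginal (8 * r) + k * ?E)"
    using sum_squared_measures_le_correlation_integral[OF prob_marginal sets_marginal c]
    by (intro mult_left_mono add_right_mono) auto
  finally show ?thesis .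
qed

end

section \<open>Separation of orbits along dyadic times\<close>

lemma summable_power_times_gaussian:
  fixes a b :: real
  assumes "a > 0" "b > 0"
  shows "summable (\<lambda>n::nat. b ^ n * exp (- ((real n * a)\<^sup>2)))"
proof (rule summable_comparison_test')
  define N where "N = nat \<lceil>(ln b + 1) / a\<^sup>2\<rceil>"
  show "summable (\<lambda>n::nat. exp (- 1 :: real) ^ n)"
    by (intro summable_geometric) auto
  fix n assume "n \<ge> N"
  then have "(ln b + 1) / a\<^sup>2 \<le> real n"
    unfolding N_def by linarith
  then have "ln b + 1 \<le> real n * a\<^sup>2"
    using \<open>a > 0\<close> by (simp add: field_simps)
  then have "real n * (ln b + 1) \<le> real n * (real n * a\<^sup>2)"
    by (intro mult_left_mono) auto
  then have "real n * ln b - (real n * a)\<^sup>2 \<le> - real n"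
    by (simp add: power2_eq_square algebra_simps)
  then have "exp (real n * ln b - (real n * a)\<^sup>2) \<le> exp (- real n)"
    by simp
  also have "exp (real n * ln b - (real n * a)\<^sup>2) = b ^ n * exp (- ((real n * a)\<^sup>2))"
    using \<open>b > 0\<close> by (simp add: exp_diff exp_minus field_simps exp_of_nat_mult)
  also have "exp (- real n) = exp (- 1) ^ n"
    using exp_of_nat_mult[of n "- 1 :: real"] by simp
  finally show "norm (b ^ n * exp (- ((real n * a)\<^sup>2))) \<le> exp (- 1) ^ n"
    using \<open>b > 0\<close> by simp
qed

context random_dynamical_system
begin

text \<open>
  There are at most \<open>4 \<cdot> 4\<^sup>l\<close> pairs of times below \<open>2\<^sup>l\<^sup>+\<^sup>1\<close>. The main term of the expected number of encounters at
  scale \<open>q\<^sup>l\<close> is therefore of order \<open>(4 q\<^sup>D)\<^sup>l\<close>, which is summable. For the error term, everything but the mixing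
  factor is at most exponential in \<open>l\<close>: the number of pairs, the number of balls, and the squared
  Lipschitz norm, of order \<open>q\<^sup>-\<^sup>2\<^sup>l\<close>. The gap makes the mixing factor at most
  \<open>exp (- (l ln 2)\<^sup>C)\<close> with exponent \<open>C = C\<^sub>4 c\<^sub>2 \<ge> 2\<close>, and such a Gaussian factor beats any exponential.
\<close>

lemma dyadic_separation:
  assumes compl: "bounded_local_complexity (UNIV :: 'x set)"
    and lip: "lipschitz_fibers \<mu>"
    and mix: "mixes_stretched_exponentially P \<theta> c\<^sub>2 C\<^sub>2"
    and C\<^sub>4: "C\<^sub>4 \<ge> 2 / c\<^sub>2"
    and q: "0 < q" "q < 1" "4 * q powr D < 1"
    and corr: "\<forall>\<^sub>F r in at_right 0. correlation_integral marginal r \<le> r powr D"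
  shows "AE \<omega> in P. AE z in \<mu> \<omega> \<Otimes>\<^sub>M \<mu> \<omega>. \<forall>\<^sub>F l in sequentially.
    \<forall>i<2 ^ (l + 1). \<forall>j<2 ^ (l + 1). gap C\<^sub>4 (2 ^ l) < \<bar>real j - real i\<bar> \<longrightarrow>
      q ^ l \<le> dist (fiber_iter \<theta> T i \<omega> (fst z)) (fiber_iter \<theta> T j \<omega> (snd z))"
proof -
  have c\<^sub>2: "0 < c\<^sub>2" "0 < C\<^sub>2"
    using mix by (auto simp: mixes_stretched_exponentially_def)
  have Cc: "2 \<le> C\<^sub>4 * c\<^sub>2"
    using C\<^sub>4 c\<^sub>2 by (simp add: field_simps)
  obtain C\<^sub>1 where "C\<^sub>1 > 0" and C\<^sub>1: "\<And>f \<omega> \<omega>'. is_lipschitz f \<Longrightarrow>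
      \<bar>(\<integral>x. f x \<partial>\<mu> \<omega>) - (\<integral>x. f x \<partial>\<mu> \<omega>')\<bar> \<le> C\<^sub>1 * lip_norm f * dist \<omega> \<omega>'"
    using lip unfolding lipschitz_fibers_def by blast
  obtain C A :: nat and K r\<^sub>0 :: real and k and c :: "real \<Rightarrow> nat \<Rightarrow> 'x" where "r\<^sub>0 > 0"
    and cover: "\<And>r. 0 < r \<Longrightarrow> r \<le> r\<^sub>0 \<Longrightarrow> bounded_cover C r (k r) (c r)"
    and k: "\<And>r. 0 < r \<Longrightarrow> r \<le> r\<^sub>0 \<Longrightarrow> real (k r) * r ^ A \<le> K"
    by (rule bounded_local_complexity_covers[OF compl]) (rule that; assumption)
  define S where "S l = {(i, j). i < 2 ^ (l + 1) \<and> j < 2 ^ (l + 1) \<and> gap C\<^sub>4 (2 ^ l) < \<bar>real j - real i\<bar>}"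
    for l :: nat
  have S_sub: "S l \<subseteq> {..<2 ^ (l + 1)} \<times> {..<2 ^ (l + 1)}" for l
    by (auto simp: S_def)
  have S_fin: "finite (S l)" for l
    using S_sub by (rule finite_subset) auto
  have S_card: "real (card (S l)) \<le> 4 * 4 ^ l" for l
  proof -
    have "card (S l) \<le> card ({..<2 ^ (l + 1) :: nat} \<times> {..<2 ^ (l + 1) :: nat})"
      using S_sub[of l] by (intro card_mono) auto
    also have "\<dots> = 4 * 4 ^ l"
      by (simp add: card_cartesian_product flip: power_mult_distrib)
    finally have "real (card (S l)) \<le> real (4 * 4 ^ l)"
      by (simp only: of_nat_le_iff)
    then show ?thesis by simp
  qed
  define H where "H l = encounter_bound (S l) (k (q ^ l)) (c (q ^ l)) (q ^ l)" for l
  define B where "B = 4 / q ^ (A + 2)"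
  \<comment> \<open>The first summand bounds the main term and the second one the mixing error.\<close>
  define a where "a l = 4 * C * 8 powr D * (4 * q powr D) ^ l
      + 4 * K * C\<^sub>2 * (1 + 2 * C\<^sub>1)\<^sup>2 * (B ^ l * exp (- ((real l * ln 2)\<^sup>2)))" for l :: nat
  have "summable a"
    unfolding a_def using q
    by (intro summable_add summable_mult summable_power_times_gaussian summable_geometric)
       (auto simp: B_def)
  have q0: "(\<lambda>l. q ^ l) \<longlonglongrightarrow> 0"
    using q by (intro LIMSEQ_realpow_zero) auto
  have "\<forall>\<^sub>F l in sequentially. q ^ l < r\<^sub>0"
    using q0 \<open>r\<^sub>0 > 0\<close> by (intro order_tendstoD)
  moreover have "\<forall>\<^sub>F l in sequentially. correlation_integral marginal (8 * q ^ l) \<le> (8 * q ^ l) powr D"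
  proof -
    have "filterlim (\<lambda>l. 8 * q ^ l) (at_right 0) sequentially"
      using q tendsto_mult_right_zero[OF q0, of 8]
      by (auto simp: filterlim_at)
    then show ?thesis
      using corr by (rule eventually_compose_filterlim[rotated])
  qed
  moreover have "\<forall>\<^sub>F l in sequentially. l \<ge> (2::nat)"
    by (rule eventually_ge_at_top)
  ultimately have "\<forall>\<^sub>F l in sequentially. q ^ l \<le> r\<^sub>0 \<and> 2 \<le> l \<and>
      correlation_integral marginal (8 * q ^ l) \<le> (8 * q ^ l) powr D"
    by eventually_elim auto
  \<comment> \<open>Requiring \<open>l \<ge> 2\<close> ensures \<open>l ln 2 \<ge> 1\<close>, so that raising the exponent of \<open>l ln 2\<close> increases the power.\<close>
  then obtain l\<^sub>0 where l\<^sub>0: "\<And>l. l \<ge> l\<^sub>0 \<Longrightarrow> q ^ l \<le> r\<^sub>0 \<and> 2 \<le> l \<and>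
      correlation_integral marginal (8 * q ^ l) \<le> (8 * q ^ l) powr D"
    unfolding eventually_sequentially by blast
  have qpos: "0 < q ^ l" "q ^ l \<le> 1" for l
    using q by (auto simp: power_le_one)
  have L: "(C\<^sub>1 * (1 + 1 / q ^ l))-lipschitz_on UNIV (fiber_cutoff z (q ^ l))" for z l
    using fiber_cutoff_lipschitz[OF qpos(1) _ C\<^sub>1] \<open>C\<^sub>1 > 0\<close> by simp
  have H_le: "(\<integral>\<omega>. H l \<omega> \<partial>P) \<le> a l" if "l \<ge> l\<^sub>0" for l
  proof -
    note l = l\<^sub>0[OF that]
    let ?r = "q ^ l"
    have gap: "gap C\<^sub>4 (2 ^ l) = (real l * ln 2) powr C\<^sub>4"
      by (simp add: gap_def ln_realpow)
    have "1 \<le> real l * ln 2"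
      using l ln2_ge_two_thirds mult_mono[of 2 "real l" "2/3" "ln 2"] by simp
    then have "(real l * ln 2) powr 2 \<le> (real l * ln 2) powr (C\<^sub>4 * c\<^sub>2)"
      using Cc by (intro powr_mono) auto
    then have gap_ge: "(real l * ln 2)\<^sup>2 \<le> gap C\<^sub>4 (2 ^ l) powr c\<^sub>2"
      using \<open>1 \<le> real l * ln 2\<close> by (simp add: gap powr_powr)
    have cor: "correlation_integral marginal (8 * ?r) \<le> 8 powr D * (q powr D) ^ l"
    proof -
      have "correlation_integral marginal (8 * ?r) \<le> (8 * ?r) powr D"
        using l by simp
      also have "\<dots> = 8 powr D * (q powr D) ^ l"
        using q by (simp add: powr_mult powr_powr mult.commute flip: powr_realpow)
      finally show ?thesis .
    qed
    have sq: "(1 + C\<^sub>1 * (1 + 1 / ?r))\<^sup>2 \<le> (1 + 2 * C\<^sub>1)\<^sup>2 / ?r ^ 2"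
    proof -
      have "1 + C\<^sub>1 * (1 + 1 / ?r) \<le> 1 / ?r + C\<^sub>1 * (1 / ?r + 1 / ?r)"
        using qpos[of l] \<open>C\<^sub>1 > 0\<close> by (intro add_mono mult_left_mono) auto
      also have "\<dots> = (1 + 2 * C\<^sub>1) / ?r"
        by (simp add: add_divide_distrib)
      finally have "(1 + C\<^sub>1 * (1 + 1 / ?r))\<^sup>2 \<le> ((1 + 2 * C\<^sub>1) / ?r)\<^sup>2"
        using qpos[of l] \<open>C\<^sub>1 > 0\<close> by (intro power_mono) auto
      then show ?thesis by (simp add: power_divide)
    qed
    have kK: "real (k ?r) \<le> K / ?r ^ A"
      using k[of ?r] l qpos[of l] by (simp add: pos_le_divide_eq)
    have "0 \<le> K"
      using k[of r\<^sub>0] \<open>r\<^sub>0 > 0\<close> by (smt (verit) mult_nonneg_nonneg of_nat_0_le_iff zero_le_power)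
    have "(\<integral>\<omega>. H l \<omega> \<partial>P) \<le> card (S l) * (C * correlation_integral marginal (8 * ?r)
        + k ?r * (C\<^sub>2 * exp (- (gap C\<^sub>4 (2 ^ l) powr c\<^sub>2)) * (1 + C\<^sub>1 * (1 + 1 / ?r))\<^sup>2))"
      unfolding H_def using l qpos[of l]
      by (intro expectation_encounter_bound_le L mix cover) (auto simp: S_def gap)
    also have "\<dots> \<le> (4 * 4 ^ l) * (C * (8 powr D * (q powr D) ^ l)
        + K / ?r ^ A * (C\<^sub>2 * exp (- ((real l * ln 2)\<^sup>2)) * ((1 + 2 * C\<^sub>1)\<^sup>2 / ?r ^ 2)))"
      using S_card cor kK gap_ge sq c\<^sub>2 \<open>0 \<le> K\<close> qpos[of l]
        correlation_integral_bounds[OF prob_marginal sets_marginal, of "8 * ?r"]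
      by (intro mult_mono add_mono) auto
    also have "\<dots> = a l"
    proof -
      have "(q ^ (A + 2)) ^ l = ?r ^ (A + 2)"
        by (simp only: power_mult[symmetric] mult.commute)
      then have B_pow: "B ^ l = 4 ^ l / (?r ^ A * ?r ^ 2)"
        by (simp only: B_def power_divide power_add)
      show ?thesis
        unfolding a_def B_pow power_mult_distrib[of 4 "q powr D"] by (simp add: algebra_simps)
    qed
    finally show ?thesis .
  qed
  have "AE \<omega> in P. AE z in \<mu> \<omega> \<Otimes>\<^sub>M \<mu> \<omega>. \<forall>\<^sub>F l in sequentially.
      z \<notin> encounters (S (l + l\<^sub>0)) (k (q ^ (l + l\<^sub>0))) (c (q ^ (l + l\<^sub>0))) (q ^ (l + l\<^sub>0)) \<omega>"
  proof (rule fibered_borel_cantelli[where H = "\<lambda>l. H (l + l\<^sub>0)"])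
    show "integrable P (H (l + l\<^sub>0))" for l
      unfolding H_def by (rule encounter_bound_integrable[OF qpos(1) L])
    show "0 \<le> H (l + l\<^sub>0) \<omega>" for l \<omega>
      unfolding H_def by (rule encounter_bound_nonneg)
    show "summable (\<lambda>l. \<integral>\<omega>. H (l + l\<^sub>0) \<omega> \<partial>P)"
    proof (rule summable_comparison_test'[where N = 0])
      show "summable (\<lambda>l. a (l + l\<^sub>0))"
        using \<open>summable a\<close> by (rule summable_ignore_initial_segment)
      show "norm (\<integral>\<omega>. H (l + l\<^sub>0) \<omega> \<partial>P) \<le> a (l + l\<^sub>0)" for l
        using H_le[of "l + l\<^sub>0"] integral_nonneg_AE[where M = P and f = "H (l + l\<^sub>0)"]
        by (simp add: H_def encounter_bound_nonneg)
    qed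
    show "prob_space (\<mu> \<omega> \<Otimes>\<^sub>M \<mu> \<omega>)" for \<omega>
      by (intro prob_space_pair prob_fiber)
    show "encounters (S (l + l\<^sub>0)) (k (q ^ (l + l\<^sub>0))) (c (q ^ (l + l\<^sub>0))) (q ^ (l + l\<^sub>0)) \<omega>
        \<in> sets (\<mu> \<omega> \<Otimes>\<^sub>M \<mu> \<omega>)" for l \<omega>
      by (intro encounters_sets S_fin)
    show "AE \<omega> in P. \<forall>l. measure (\<mu> \<omega> \<Otimes>\<^sub>M \<mu> \<omega>)
        (encounters (S (l + l\<^sub>0)) (k (q ^ (l + l\<^sub>0))) (c (q ^ (l + l\<^sub>0))) (q ^ (l + l\<^sub>0)) \<omega>) \<le> H (l + l\<^sub>0) \<omega>"
      unfolding AE_all_countable H_def by (intro allI measure_encounters_le qpos S_fin)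
  qed
  then show ?thesis
  proof eventually_elim
    case (elim \<omega>)
    then show ?case
    proof eventually_elim
      case (elim z)
      have "\<forall>\<^sub>F l in sequentially. \<forall>i<2 ^ (l + l\<^sub>0 + 1). \<forall>j<2 ^ (l + l\<^sub>0 + 1).
          gap C\<^sub>4 (2 ^ (l + l\<^sub>0)) < \<bar>real j - real i\<bar> \<longrightarrow>
          q ^ (l + l\<^sub>0) \<le> dist (fiber_iter \<theta> T i \<omega> (fst z)) (fiber_iter \<theta> T j \<omega> (snd z))"
        using elim
      proof eventually_elim
        case (elim l)
        have "bounded_cover C (q ^ (l + l\<^sub>0)) (k (q ^ (l + l\<^sub>0))) (c (q ^ (l + l\<^sub>0)))"
          using l\<^sub>0[of "l + l\<^sub>0"] by (intro cover qpos) auto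
        from dist_ge_outside_encounters[OF this, of "fst z" "snd z"] elim show ?case
          by (auto simp: S_def)
      qed
      then show ?case
        by (subst (asm) eventually_sequentially_seg
            [where P = "\<lambda>l. \<forall>i<2 ^ (l + 1). \<forall>j<2 ^ (l + 1). gap C\<^sub>4 (2 ^ l) < \<bar>real j - real i\<bar> \<longrightarrow>
              q ^ l \<le> dist (fiber_iter \<theta> T i \<omega> (fst z)) (fiber_iter \<theta> T j \<omega> (snd z))"])
    qed
  qed
qed

end

section \<open>The growth rate of the shortest distance\<close>

text \<open>
  For \<open>2\<^sup>l \<le> n < 2\<^sup>l\<^sup>+\<^sup>1\<close>, the pairs of times allowed at \<open>n\<close> are among those with times below \<open>2\<^sup>l\<^sup>+\<^sup>1\<close> and gap
  above that of \<open>2\<^sup>l\<close>, because the gap function is monotone. So the shortest distance at \<open>n\<close> is at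
  least \<open>2\<^sup>-\<^sup>s\<^sup>l \<ge> n\<^sup>-\<^sup>s\<close>.
\<close>

lemma limsup_min_dist_gap_le:
  assumes sep: "\<forall>\<^sub>F l in sequentially. \<forall>i<2 ^ (l + 1). \<forall>j<2 ^ (l + 1).
      gap C (2 ^ l) < \<bar>real j - real i\<bar> \<longrightarrow>
      (2 powr - s) ^ l \<le> dist (fiber_iter \<theta> T i \<omega> x) (fiber_iter \<theta> T j \<omega> y)"
    and s: "s > 0" and C: "C \<ge> 0"
  shows "limsup (\<lambda>n. - elog (min_dist_gap \<theta> T (gap C) n \<omega> x y) / ereal (ln (real n))) \<le> ereal s"
proof (rule Limsup_bounded)
  obtain l\<^sub>0 where l\<^sub>0: "\<And>l i j. l \<ge> l\<^sub>0 \<Longrightarrow> i < 2 ^ (l + 1) \<Longrightarrow> j < 2 ^ (l + 1) \<Longrightarrow>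
      gap C (2 ^ l) < \<bar>real j - real i\<bar> \<Longrightarrow>
      (2 powr - s) ^ l \<le> dist (fiber_iter \<theta> T i \<omega> x) (fiber_iter \<theta> T j \<omega> y)"
    using sep unfolding eventually_sequentially by blast
  have "\<forall>\<^sub>F n in sequentially. n \<ge> 2 ^ (l\<^sub>0 + 1)"
    by (rule eventually_ge_at_top)
  then show "\<forall>\<^sub>F n in sequentially.
      - elog (min_dist_gap \<theta> T (gap C) n \<omega> x y) / ereal (ln (real n)) \<le> ereal s"
  proof eventually_elim
    case (elim n)
    have "n \<ge> 2"
      using elim self_le_power[of "2::nat" "l\<^sub>0 + 1"] by linarith
    then have "n \<ge> 1" "ln (real n) > 0"
      by simp_all
    from this(1) obtain l where l: "2 ^ l \<le> n" "n < 2 ^ (l + 1)"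
      using ex_power_ivl1[of 2 n] by auto
    have "2 ^ (l\<^sub>0 + 1) < (2::nat) ^ (l + 1)"
      using elim l by linarith
    then have "l \<ge> l\<^sub>0" by simp
    have ln_le: "real l * ln 2 \<le> ln (real n)"
    proof -
      have "ln (real (2 ^ l)) \<le> ln (real n)"
        using l(1) \<open>n \<ge> 1\<close> by (intro ln_mono) (simp_all only: of_nat_le_iff of_nat_0_less_iff, auto)
      then show ?thesis by (simp add: ln_realpow)
    qed
    have gap_le: "gap C (2 ^ l) \<le> gap C n"
      unfolding gap_def using ln_le C by (intro powr_mono2) (auto simp: ln_realpow)
    let ?m = "min_dist_gap \<theta> T (gap C) n \<omega> x y"
    have m: "ereal ((2 powr - s) ^ l) \<le> ?m"
      unfolding min_dist_gap_def
      using l\<^sub>0[OF \<open>l \<ge> l\<^sub>0\<close>] l(2) gap_le by (intro Inf_greatest) (force simp: abs_minus_commute)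
    have "- elog ?m \<le> ereal (s * ln (real n))"
    proof (cases ?m)
      case (real d)
      have "0 < (2 powr - s) ^ l" by simp
      also have d: "(2 powr - s) ^ l \<le> d"
        using m real by simp
      finally have "0 < d" .
      have "- ln d \<le> - ln ((2 powr - s) ^ l)"
        using d by (intro le_imp_neg_le ln_mono) auto
      also have "\<dots> = s * (real l * ln 2)"
        by (simp add: ln_realpow ln_powr)
      also have "\<dots> \<le> s * ln (real n)"
        using ln_le s by (intro mult_left_mono) auto
      finally show ?thesis
        using real \<open>0 < d\<close> by (simp add: elog_def)
    qed (use m in \<open>auto simp: elog_def\<close>)
    with \<open>ln (real n) > 0\<close> show ?case
      by (subst ereal_divide_le_pos) (simp_all add: mult.commute)
  qed
qed

theorem proposition1p10:
  fixes P :: "'w::metric_space measure"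
    and \<theta> :: "'w \<Rightarrow> 'w"
    and T :: "'w \<Rightarrow> 'x::metric_space \<Rightarrow> 'x"
    and \<nu> :: "('w \<times> 'x) measure"
    and \<mu> :: "'w \<Rightarrow> 'x measure"
    and c\<^sub>2 C\<^sub>2 C\<^sub>4 :: real
  assumes "random_dynamical_system P \<theta> T \<nu> \<mu>"
    and "compact (UNIV :: 'x set)"
    and "bounded_local_complexity (UNIV :: 'x set)"
    and "lipschitz_fibers \<mu>"
    and "mixes_stretched_exponentially P \<theta> c\<^sub>2 C\<^sub>2"
    and "C\<^sub>4 \<ge> 2 / c\<^sub>2"
  shows "AE \<omega> in P. AE (x, y) in \<mu> \<omega> \<Otimes>\<^sub>M \<mu> \<omega>.
    limsup (\<lambda>n. - elog (min_dist_gap \<theta> T (gap C\<^sub>4) n \<omega> x y) / ereal (ln (real n)))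
      \<le> 2 / lower_annealed_dimension \<nu>"
proof -
  interpret random_dynamical_system P \<theta> T \<nu> \<mu> by fact
  let ?D = "lower_annealed_dimension \<nu>"
  let ?lim = "\<lambda>\<omega> z. limsup (\<lambda>n. - elog (min_dist_gap \<theta> T (gap C\<^sub>4) n \<omega> (fst z) (snd z)) / ereal (ln (real n)))"
  have D: "?D = lower_correlation_dimension marginal"
    by (simp add: lower_annealed_dimension_def marginal_def)
  have "0 \<le> ?D"
    unfolding D by (rule lower_correlation_dimension_nonneg[OF prob_marginal sets_marginal])
  have "c\<^sub>2 > 0"
    using assms(5) by (simp add: mixes_stretched_exponentially_def)
  then have "C\<^sub>4 \<ge> 0"
    using assms(6) by (smt (verit) divide_nonneg_pos)
  have *: "AE \<omega> in P. AE z in \<mu> \<omega> \<Otimes>\<^sub>M \<mu> \<omega>. ?lim \<omega> z \<le> ereal s" if s: "2 / ?D < ereal s" for s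
  proof -
    have "0 \<le> 2 / ?D"
      using \<open>0 \<le> ?D\<close> by simp
    then have "0 < s"
      using s by (metis ereal_less(2) order_le_less_trans)
    \<comment> \<open>This includes the case of infinite dimension, where the bound \<open>2 / ?D\<close> is \<open>0\<close> and every \<open>s > 0\<close> is allowed.\<close>
    have "ereal (2 / s) < ?D"
    proof (cases ?D)
      case (real d)
      with \<open>0 \<le> ?D\<close> s have "d > 0"
        by (cases "d = 0") auto
      with real s \<open>0 < s\<close> have "2 / d < s"
        by simp
      with real \<open>d > 0\<close> \<open>0 < s\<close> show ?thesis
        by (simp add: field_simps)
    qed (use \<open>0 \<le> ?D\<close> in auto)
    then obtain D' where D': "2 / s < D'" "ereal D' < ?D"
      using ereal_dense2[of "ereal (2 / s)" ?D] by auto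
    have "2 < s * D'"
      using D' \<open>0 < s\<close> by (simp add: field_simps)
    have "AE \<omega> in P. AE z in \<mu> \<omega> \<Otimes>\<^sub>M \<mu> \<omega>. \<forall>\<^sub>F l in sequentially.
      \<forall>i<2 ^ (l + 1). \<forall>j<2 ^ (l + 1). gap C\<^sub>4 (2 ^ l) < \<bar>real j - real i\<bar> \<longrightarrow>
      (2 powr - s) ^ l \<le> dist (fiber_iter \<theta> T i \<omega> (fst z)) (fiber_iter \<theta> T j \<omega> (snd z))"
    proof (rule dyadic_separation[OF assms(3-6)])
      show "2 powr - s < 1"
        using \<open>0 < s\<close> by (simp add: powr_less_one)
      have "(2 powr - s) powr D' < 2 powr - 2"
        using \<open>2 < s * D'\<close> by (simp add: powr_powr)
      then show "4 * (2 powr - s) powr D' < 1"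
        by (simp add: powr_minus powr_numeral)
      show "\<forall>\<^sub>F r in at_right 0. correlation_integral marginal r \<le> r powr D'"
        using D'(2) unfolding D by (rule correlation_integral_le_powr[OF prob_marginal sets_marginal])
    qed simp
    then show ?thesis
    proof eventually_elim
      case (elim \<omega>)
      then show ?case
        by eventually_elim (rule limsup_min_dist_gap_le[OF _ \<open>0 < s\<close> \<open>0 \<le> C\<^sub>4\<close>])
    qed
  qed
  \<comment> \<open>Exceptional sets are collected over the countably many rational \<open>s\<close>, in the base and then in the fiber.\<close>
  have "AE \<omega> in P. \<forall>s::rat. 2 / ?D < ereal (of_rat s) \<longrightarrow>
      (AE z in \<mu> \<omega> \<Otimes>\<^sub>M \<mu> \<omega>. ?lim \<omega> z \<le> ereal (of_rat s))"
    unfolding AE_all_countable using * by auto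
  then show ?thesis
  proof eventually_elim
    case (elim \<omega>)
    then have "AE z in \<mu> \<omega> \<Otimes>\<^sub>M \<mu> \<omega>. \<forall>s::rat. 2 / ?D < ereal (of_rat s) \<longrightarrow> ?lim \<omega> z \<le> ereal (of_rat s)"
      unfolding AE_all_countable by auto
    then show ?case
    proof eventually_elim
      case (elim z)
      have "?lim \<omega> z \<le> 2 / ?D"
      proof (rule dense_ge)
        fix t assume "2 / ?D < t"
        then obtain r where r: "2 / ?D < ereal r" "ereal r < t"
          using ereal_dense2 by blast
        then obtain r' where r': "ereal r < ereal r'" "ereal r' < t"
          using ereal_dense2 by blast
        then obtain s :: rat where s: "r < of_rat s" "of_rat s < r'"
          using of_rat_dense[of r r'] by auto
        then have "2 / ?D < ereal (of_rat s)"
          using r by (meson less_ereal.simps(1) less_trans)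
        then have "?lim \<omega> z \<le> ereal (of_rat s)"
          using elim by blast
        also have "\<dots> \<le> t"
          using s r' by (meson less_ereal.simps(1) less_imp_le less_trans)
        finally show "?lim \<omega> z \<le> t" .
      qed
      then show ?case
        by (cases z) simp
    qed
  qed
qed

end
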